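(* Let $V$ be a vector space and $f:V\to V$ a linear endomorphism. Let $\phi_{PL}:Prelie(V)\to T_+(V,f)$ be the pre-Lie algebra morphism, and $\phi_{CPL}:ComPrelie(V)\to T_+(V,f)$ the Com-Pre-Lie algebra morphism, sending each generator $v\in V$ to the one-letter word $v$. 1. $\phi_{PL}$ is surjective if, and only if, $f(V)=V$. 2. $\phi_{CPL}$ is surjective if, and only if, the codimension of $f(V)$ in $V$ is $\le 1$.
   Context: $\mathbb{K}$ is a field of characteristic zero. For a vector space $V$, $T(V)=\bigoplus_{n\ge 0}V^{\otimes n}$ is spanned by words with letters in $V$; $\emptyset$ is the empty word; juxtaposition is concatenation; $T_+(V)=\bigoplus_{n\ge 1}V^{\otimes n}$. The shuffle product $\sqcup\!\sqcup$ is the bilinear product with unit $\emptyset$ and $xu\sqcup\!\sqcup yv=x(u\sqcup\!\sqcup yv)+y(xu\sqcup\!\sqcup v)$ for $x,y\in V$, $u,v\in T(V)$. The bilinear product $\bullet$ on $T(V)$ is defined by $\emptyset\bullet w'=0$ and $(xw)\bullet w'=x(w\bullet w')+f(x)(w\sqcup\!\sqcup w')$ for $x\in V$, $w,w'\in T(V)$. $T(V,f)$ is $T(V)$ with these products, and $T_+(V,f)$ is $T_+(V)$, which is stable under both products. A Com-Pre-Lie algebra has a commutative associative product $\sqcup\!\sqcup$ (not necessarily unitary) and a right pre-Lie product $\bullet$, i.e. $(a\bullet b)\bullet c-a\bullet(b\bullet c)=(a\bullet c)\bullet b-a\bullet(c\bullet b)$, such that $(a\sqcup\!\sqcup b)\bullet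 c=(a\bullet c)\sqcup\!\sqcup b+a\sqcup\!\sqcup(b\bullet c)$; $T_+(V,f)$ is one. $Prelie(V)$ and $ComPrelie(V)$ are the free (right) pre-Lie algebra and the free non-unitary Com-Pre-Lie algebra generated by the vector space $V$. *)

theory Defs
  imports Complex_Main "HOL-Library.Poly_Mapping" "HOL-Library.FuncSet" "HOL-Library.Extended_Nat"
begin

section \<open>Pre-Lie and Com-Pre-Lie algebras\<close>

record ('k, 'a) prelie_struct =
  carrier :: "'a set"
  zero :: 'a
  add :: "'a \<Rightarrow> 'a \<Rightarrow> 'a"
  smult :: "'k \<Rightarrow> 'a \<Rightarrow> 'a"
  pre :: "'a \<Rightarrow> 'a \<Rightarrow> 'a"

record ('k, 'a) comprelie_struct = "('k, 'a) prelie_struct" +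
  shuf :: "'a \<Rightarrow> 'a \<Rightarrow> 'a"

definition subtract :: "('k::field, 'a, 'm) prelie_struct_scheme \<Rightarrow> 'a \<Rightarrow> 'a \<Rightarrow> 'a" where
  "subtract A x y = add A x (smult A (- 1) y)"

locale prelie_algebra =
  fixes A :: "('k::field, 'a, 'm) prelie_struct_scheme"
  assumes zero_closed: "zero A \<in> carrier A"
    and add_closed: "\<lbrakk>x \<in> carrier A; y \<in> carrier A\<rbrakk> \<Longrightarrow> add A x y \<in> carrier A"
    and smult_closed: "x \<in> carrier A \<Longrightarrow> smult A c x \<in> carrier A"
    and pre_closed: "\<lbrakk>x \<in> carrier A; y \<in> carrier A\<rbrakk> \<Longrightarrow> pre A x y \<in> carrier A"
    and add_assoc: "\<lbrakk>x \<in> carrier A; y \<in> carrier A; z \<in> carrier A\<rbrakk>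
      \<Longrightarrow> add A (add A x y) z = add A x (add A y z)"
    and add_comm: "\<lbrakk>x \<in> carrier A; y \<in> carrier A\<rbrakk> \<Longrightarrow> add A x y = add A y x"
    and add_zero: "x \<in> carrier A \<Longrightarrow> add A x (zero A) = x"
    and add_uminus: "x \<in> carrier A \<Longrightarrow> add A x (smult A (- 1) x) = zero A"
    and smult_add: "\<lbrakk>x \<in> carrier A; y \<in> carrier A\<rbrakk>
      \<Longrightarrow> smult A c (add A x y) = add A (smult A c x) (smult A c y)"
    and add_smult: "x \<in> carrier A \<Longrightarrow> smult A (c + d) x = add A (smult A c x) (smult A d x)"
    and smult_smult: "x \<in> carrier A \<Longrightarrow> smult A c (smult A d x) = smult A (c * d) x"
    and smult_one: "x \<in> carrier A \<Longrightarrow> smult A 1 x = x"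
    and pre_add_left: "\<lbrakk>x \<in> carrier A; y \<in> carrier A; z \<in> carrier A\<rbrakk>
      \<Longrightarrow> pre A (add A x y) z = add A (pre A x z) (pre A y z)"
    and pre_add_right: "\<lbrakk>x \<in> carrier A; y \<in> carrier A; z \<in> carrier A\<rbrakk>
      \<Longrightarrow> pre A x (add A y z) = add A (pre A x y) (pre A x z)"
    and pre_smult_left: "\<lbrakk>x \<in> carrier A; y \<in> carrier A\<rbrakk>
      \<Longrightarrow> pre A (smult A c x) y = smult A c (pre A x y)"
    and pre_smult_right: "\<lbrakk>x \<in> carrier A; y \<in> carrier A\<rbrakk>
      \<Longrightarrow> pre A x (smult A c y) = smult A c (pre A x y)"
    and prelie: "\<lbrakk>x \<in> carrier A; y \<in> carrier A; z \<in> carrier A\<rbrakk>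
      \<Longrightarrow> subtract A (pre A (pre A x y) z) (pre A x (pre A y z))
        = subtract A (pre A (pre A x z) y) (pre A x (pre A z y))"

locale comprelie_algebra = prelie_algebra A
  for A :: "('k::field, 'a, 'm) comprelie_struct_scheme" +
  assumes shuf_closed: "\<lbrakk>x \<in> carrier A; y \<in> carrier A\<rbrakk> \<Longrightarrow> shuf A x y \<in> carrier A"
    and shuf_add_left: "\<lbrakk>x \<in> carrier A; y \<in> carrier A; z \<in> carrier A\<rbrakk>
      \<Longrightarrow> shuf A (add A x y) z = add A (shuf A x z) (shuf A y z)"
    and shuf_smult_left: "\<lbrakk>x \<in> carrier A; y \<in> carrier A\<rbrakk>
      \<Longrightarrow> shuf A (smult A c x) y = smult A c (shuf A x y)"
    and shuf_comm: "\<lbrakk>x \<in> carrier A; y \<in> carrier A\<rbrakk> \<Longrightarrow> shuf A x y = shuf A y x"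
    and shuf_assoc: "\<lbrakk>x \<in> carrier A; y \<in> carrier A; z \<in> carrier A\<rbrakk>
      \<Longrightarrow> shuf A (shuf A x y) z = shuf A x (shuf A y z)"
    and leibniz: "\<lbrakk>x \<in> carrier A; y \<in> carrier A; z \<in> carrier A\<rbrakk>
      \<Longrightarrow> pre A (shuf A x y) z = add A (shuf A (pre A x z) y) (shuf A x (pre A y z))"

definition prelie_hom ::
  "('k, 'a, 'm) prelie_struct_scheme \<Rightarrow> ('k, 'b, 'n) prelie_struct_scheme \<Rightarrow> ('a \<Rightarrow> 'b) set" where
  "prelie_hom A B = {\<phi> \<in> carrier A \<rightarrow> carrier B.
     (\<forall>x\<in>carrier A. \<forall>y\<in>carrier A. \<phi> (add A x y) = add B (\<phi> x) (\<phi> y)) \<and>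
     (\<forall>c. \<forall>x\<in>carrier A. \<phi> (smult A c x) = smult B c (\<phi> x)) \<and>
     (\<forall>x\<in>carrier A. \<forall>y\<in>carrier A. \<phi> (pre A x y) = pre B (\<phi> x) (\<phi> y))}"

definition comprelie_hom ::
  "('k, 'a, 'm) comprelie_struct_scheme \<Rightarrow> ('k, 'b, 'n) comprelie_struct_scheme \<Rightarrow> ('a \<Rightarrow> 'b) set" where
  "comprelie_hom A B = {\<phi> \<in> prelie_hom A B.
     \<forall>x\<in>carrier A. \<forall>y\<in>carrier A. \<phi> (shuf A x y) = shuf B (\<phi> x) (\<phi> y)}"

definition linear_into ::
  "('k \<Rightarrow> 'v \<Rightarrow> 'v) \<Rightarrow> ('k, 'a, 'm) prelie_struct_scheme \<Rightarrow> ('v::ab_group_add \<Rightarrow> 'a) \<Rightarrow> bool" where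
  "linear_into scale A g \<longleftrightarrow> (\<forall>v. g v \<in> carrier A) \<and>
     (\<forall>v w. g (v + w) = add A (g v) (g w)) \<and> (\<forall>c v. g (scale c v) = smult A c (g v))"

section \<open>Operations on quotients\<close>

definition lift1 :: "('c \<times> 'c) set \<Rightarrow> ('c \<Rightarrow> 'c) \<Rightarrow> 'c set \<Rightarrow> 'c set" where
  "lift1 R h X = (\<Union>a\<in>X. R `` {h a})"

definition lift2 :: "('c \<times> 'c) set \<Rightarrow> ('c \<Rightarrow> 'c \<Rightarrow> 'c) \<Rightarrow> 'c set \<Rightarrow> 'c set \<Rightarrow> 'c set" where
  "lift2 R h X Y = (\<Union>a\<in>X. \<Union>b\<in>Y. R `` {h a b})"

section \<open>Free pre-Lie and Com-Pre-Lie algebras on a vector space\<close>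

text \<open>The free algebras are built as terms over the vector space modulo the least congruence that
  contains the vector space axioms, bilinearity of the products, linearity of the inclusion of
  generators, and the defining identities.  The universal properties are proved below.\<close>

datatype ('k, 'v) plterm =
  PGen 'v
| PZero
| PAdd "('k, 'v) plterm" "('k, 'v) plterm"
| PScale 'k "('k, 'v) plterm"
| PPre "('k, 'v) plterm" "('k, 'v) plterm"

inductive pl_eq :: "('k::field \<Rightarrow> 'v::ab_group_add \<Rightarrow> 'v)
    \<Rightarrow> ('k, 'v) plterm \<Rightarrow> ('k, 'v) plterm \<Rightarrow> bool"
  for scale :: "'k \<Rightarrow> 'v \<Rightarrow> 'v" where
  pl_refl: "pl_eq scale s s"
| pl_sym: "pl_eq scale s t \<Longrightarrow> pl_eq scale t s"
| pl_trans: "pl_eq scale s t \<Longrightarrow> pl_eq scale t u \<Longrightarrow> pl_eq scale s u"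
| pl_cong_add: "pl_eq scale s s' \<Longrightarrow> pl_eq scale t t' \<Longrightarrow> pl_eq scale (PAdd s t) (PAdd s' t')"
| pl_cong_scale: "pl_eq scale s s' \<Longrightarrow> pl_eq scale (PScale c s) (PScale c s')"
| pl_cong_pre: "pl_eq scale s s' \<Longrightarrow> pl_eq scale t t' \<Longrightarrow> pl_eq scale (PPre s t) (PPre s' t')"
| pl_gen_add: "pl_eq scale (PGen (v + w)) (PAdd (PGen v) (PGen w))"
| pl_gen_scale: "pl_eq scale (PGen (scale c v)) (PScale c (PGen v))"
| pl_add_assoc: "pl_eq scale (PAdd (PAdd s t) u) (PAdd s (PAdd t u))"
| pl_add_comm: "pl_eq scale (PAdd s t) (PAdd t s)"
| pl_add_zero: "pl_eq scale (PAdd s PZero) s"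
| pl_add_uminus: "pl_eq scale (PAdd s (PScale (- 1) s)) PZero"
| pl_smult_add: "pl_eq scale (PScale c (PAdd s t)) (PAdd (PScale c s) (PScale c t))"
| pl_add_smult: "pl_eq scale (PScale (c + d) s) (PAdd (PScale c s) (PScale d s))"
| pl_smult_smult: "pl_eq scale (PScale c (PScale d s)) (PScale (c * d) s)"
| pl_smult_one: "pl_eq scale (PScale 1 s) s"
| pl_pre_add_left: "pl_eq scale (PPre (PAdd s t) u) (PAdd (PPre s u) (PPre t u))"
| pl_pre_add_right: "pl_eq scale (PPre s (PAdd t u)) (PAdd (PPre s t) (PPre s u))"
| pl_pre_smult_left: "pl_eq scale (PPre (PScale c s) t) (PScale c (PPre s t))"
| pl_pre_smult_right: "pl_eq scale (PPre s (PScale c t)) (PScale c (PPre s t))"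
| pl_prelie: "pl_eq scale
    (PAdd (PPre (PPre s t) u) (PScale (- 1) (PPre s (PPre t u))))
    (PAdd (PPre (PPre s u) t) (PScale (- 1) (PPre s (PPre u t))))"

definition pl_rel :: "('k::field \<Rightarrow> 'v::ab_group_add \<Rightarrow> 'v)
    \<Rightarrow> (('k, 'v) plterm \<times> ('k, 'v) plterm) set" where
  "pl_rel scale = {(s, t). pl_eq scale s t}"

definition Prelie :: "('k::field \<Rightarrow> 'v::ab_group_add \<Rightarrow> 'v)
    \<Rightarrow> ('k, ('k, 'v) plterm set) prelie_struct" where
  "Prelie scale = \<lparr>
     carrier = UNIV // pl_rel scale,
     zero = pl_rel scale `` {PZero},
     add = lift2 (pl_rel scale) PAdd,
     smult = (\<lambda>c. lift1 (pl_rel scale) (PScale c)),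
     pre = lift2 (pl_rel scale) PPre\<rparr>"

definition pl_gen :: "('k::field \<Rightarrow> 'v::ab_group_add \<Rightarrow> 'v) \<Rightarrow> 'v \<Rightarrow> ('k, 'v) plterm set" where
  "pl_gen scale v = pl_rel scale `` {PGen v}"

datatype ('k, 'v) cplterm =
  CGen 'v
| CZero
| CAdd "('k, 'v) cplterm" "('k, 'v) cplterm"
| CScale 'k "('k, 'v) cplterm"
| CPre "('k, 'v) cplterm" "('k, 'v) cplterm"
| CSh "('k, 'v) cplterm" "('k, 'v) cplterm"

inductive cpl_eq :: "('k::field \<Rightarrow> 'v::ab_group_add \<Rightarrow> 'v)
    \<Rightarrow> ('k, 'v) cplterm \<Rightarrow> ('k, 'v) cplterm \<Rightarrow> bool"
  for scale :: "'k \<Rightarrow> 'v \<Rightarrow> 'v" where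
  cpl_refl: "cpl_eq scale s s"
| cpl_sym: "cpl_eq scale s t \<Longrightarrow> cpl_eq scale t s"
| cpl_trans: "cpl_eq scale s t \<Longrightarrow> cpl_eq scale t u \<Longrightarrow> cpl_eq scale s u"
| cpl_cong_add: "cpl_eq scale s s' \<Longrightarrow> cpl_eq scale t t' \<Longrightarrow> cpl_eq scale (CAdd s t) (CAdd s' t')"
| cpl_cong_scale: "cpl_eq scale s s' \<Longrightarrow> cpl_eq scale (CScale c s) (CScale c s')"
| cpl_cong_pre: "cpl_eq scale s s' \<Longrightarrow> cpl_eq scale t t' \<Longrightarrow> cpl_eq scale (CPre s t) (CPre s' t')"
| cpl_cong_sh: "cpl_eq scale s s' \<Longrightarrow> cpl_eq scale t t' \<Longrightarrow> cpl_eq scale (CSh s t) (CSh s' t')"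
| cpl_gen_add: "cpl_eq scale (CGen (v + w)) (CAdd (CGen v) (CGen w))"
| cpl_gen_scale: "cpl_eq scale (CGen (scale c v)) (CScale c (CGen v))"
| cpl_add_assoc: "cpl_eq scale (CAdd (CAdd s t) u) (CAdd s (CAdd t u))"
| cpl_add_comm: "cpl_eq scale (CAdd s t) (CAdd t s)"
| cpl_add_zero: "cpl_eq scale (CAdd s CZero) s"
| cpl_add_uminus: "cpl_eq scale (CAdd s (CScale (- 1) s)) CZero"
| cpl_smult_add: "cpl_eq scale (CScale c (CAdd s t)) (CAdd (CScale c s) (CScale c t))"
| cpl_add_smult: "cpl_eq scale (CScale (c + d) s) (CAdd (CScale c s) (CScale d s))"
| cpl_smult_smult: "cpl_eq scale (CScale c (CScale d s)) (CScale (c * d) s)"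
| cpl_smult_one: "cpl_eq scale (CScale 1 s) s"
| cpl_pre_add_left: "cpl_eq scale (CPre (CAdd s t) u) (CAdd (CPre s u) (CPre t u))"
| cpl_pre_add_right: "cpl_eq scale (CPre s (CAdd t u)) (CAdd (CPre s t) (CPre s u))"
| cpl_pre_smult_left: "cpl_eq scale (CPre (CScale c s) t) (CScale c (CPre s t))"
| cpl_pre_smult_right: "cpl_eq scale (CPre s (CScale c t)) (CScale c (CPre s t))"
| cpl_prelie: "cpl_eq scale
    (CAdd (CPre (CPre s t) u) (CScale (- 1) (CPre s (CPre t u))))
    (CAdd (CPre (CPre s u) t) (CScale (- 1) (CPre s (CPre u t))))"
| cpl_sh_add_left: "cpl_eq scale (CSh (CAdd s t) u) (CAdd (CSh s u) (CSh t u))"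
| cpl_sh_smult_left: "cpl_eq scale (CSh (CScale c s) t) (CScale c (CSh s t))"
| cpl_sh_comm: "cpl_eq scale (CSh s t) (CSh t s)"
| cpl_sh_assoc: "cpl_eq scale (CSh (CSh s t) u) (CSh s (CSh t u))"
| cpl_leibniz: "cpl_eq scale (CPre (CSh s t) u) (CAdd (CSh (CPre s u) t) (CSh s (CPre t u)))"

definition cpl_rel :: "('k::field \<Rightarrow> 'v::ab_group_add \<Rightarrow> 'v)
    \<Rightarrow> (('k, 'v) cplterm \<times> ('k, 'v) cplterm) set" where
  "cpl_rel scale = {(s, t). cpl_eq scale s t}"

definition ComPrelie :: "('k::field \<Rightarrow> 'v::ab_group_add \<Rightarrow> 'v)
    \<Rightarrow> ('k, ('k, 'v) cplterm set) comprelie_struct" where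
  "ComPrelie scale = \<lparr>
     carrier = UNIV // cpl_rel scale,
     zero = cpl_rel scale `` {CZero},
     add = lift2 (cpl_rel scale) CAdd,
     smult = (\<lambda>c. lift1 (cpl_rel scale) (CScale c)),
     pre = lift2 (cpl_rel scale) CPre,
     shuf = lift2 (cpl_rel scale) CSh\<rparr>"

definition cpl_gen :: "('k::field \<Rightarrow> 'v::ab_group_add \<Rightarrow> 'v) \<Rightarrow> 'v \<Rightarrow> ('k, 'v) cplterm set" where
  "cpl_gen scale v = cpl_rel scale `` {CGen v}"

section \<open>Formal linear combinations\<close>

definition pm_scale :: "'k::field \<Rightarrow> ('a \<Rightarrow>\<^sub>0 'k) \<Rightarrow> ('a \<Rightarrow>\<^sub>0 'k)" where
  "pm_scale c p = Poly_Mapping.map ((*) c) p"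

definition linear_ext :: "('a \<Rightarrow> ('b \<Rightarrow>\<^sub>0 'k::field)) \<Rightarrow> ('a \<Rightarrow>\<^sub>0 'k) \<Rightarrow> ('b \<Rightarrow>\<^sub>0 'k)" where
  "linear_ext h p = (\<Sum>a\<in>Poly_Mapping.keys p. pm_scale (Poly_Mapping.lookup p a) (h a))"

definition bilinear_ext ::
  "('a \<Rightarrow> 'b \<Rightarrow> ('c \<Rightarrow>\<^sub>0 'k::field)) \<Rightarrow> ('a \<Rightarrow>\<^sub>0 'k) \<Rightarrow> ('b \<Rightarrow>\<^sub>0 'k) \<Rightarrow> ('c \<Rightarrow>\<^sub>0 'k)" where
  "bilinear_ext h p q = linear_ext (\<lambda>a. linear_ext (h a) q) p"

abbreviation word :: "'v list \<Rightarrow> ('v list \<Rightarrow>\<^sub>0 'k::field)" where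
  "word w \<equiv> Poly_Mapping.single w 1"

definition prepend :: "'v \<Rightarrow> ('v list \<Rightarrow>\<^sub>0 'k::field) \<Rightarrow> ('v list \<Rightarrow>\<^sub>0 'k)" where
  "prepend x = linear_ext (\<lambda>w. word (x # w))"

section \<open>The algebras \<open>T(V,f)\<close> and \<open>T\<^sub>+(V,f)\<close>\<close>

text \<open>The tensor algebra is the space of formal linear combinations of lists of vectors, modulo
  multilinearity of the list in each of its entries; so it is the direct sum of the tensor powers.
  The products are given on lists by the usual recursions, extended bilinearly, and then pass to
  the quotient.\<close>

definition tensor_null :: "('k::field \<Rightarrow> 'v::ab_group_add \<Rightarrow> 'v) \<Rightarrow> ('v list \<Rightarrow>\<^sub>0 'k) set" where
  "tensor_null scale = module.span pm_scale
     ({word (u @ (x + y) # w) - word (u @ x # w) - word (u @ y # w) | u x y w. True} \<union>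
      {word (u @ scale c x # w) - pm_scale c (word (u @ x # w)) | u c x w. True})"

definition tensor_rel :: "('k::field \<Rightarrow> 'v::ab_group_add \<Rightarrow> 'v)
    \<Rightarrow> (('v list \<Rightarrow>\<^sub>0 'k) \<times> ('v list \<Rightarrow>\<^sub>0 'k)) set" where
  "tensor_rel scale = {(p, q). p - q \<in> tensor_null scale}"

fun shuffle_word :: "'v list \<Rightarrow> 'v list \<Rightarrow> ('v list \<Rightarrow>\<^sub>0 'k::field)" where
  "shuffle_word [] v = word v"
| "shuffle_word u [] = word u"
| "shuffle_word (x # u) (y # v) =
     prepend x (shuffle_word u (y # v)) + prepend y (shuffle_word (x # u) v)"

fun pre_word :: "('v \<Rightarrow> 'v) \<Rightarrow> 'v list \<Rightarrow> 'v list \<Rightarrow> ('v list \<Rightarrow>\<^sub>0 'k::field)" where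
  "pre_word f [] w' = 0"
| "pre_word f (x # w) w' = prepend x (pre_word f w w') + prepend (f x) (shuffle_word w w')"

definition T :: "('k::field \<Rightarrow> 'v::ab_group_add \<Rightarrow> 'v) \<Rightarrow> ('v \<Rightarrow> 'v)
    \<Rightarrow> ('k, ('v list \<Rightarrow>\<^sub>0 'k) set) comprelie_struct" where
  "T scale f = \<lparr>
     carrier = UNIV // tensor_rel scale,
     zero = tensor_rel scale `` {0},
     add = lift2 (tensor_rel scale) (+),
     smult = (\<lambda>c. lift1 (tensor_rel scale) (pm_scale c)),
     pre = lift2 (tensor_rel scale) (bilinear_ext (pre_word f)),
     shuf = lift2 (tensor_rel scale) (bilinear_ext shuffle_word)\<rparr>"

definition T_plus :: "('k::field \<Rightarrow> 'v::ab_group_add \<Rightarrow> 'v) \<Rightarrow> ('v \<Rightarrow> 'v)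
    \<Rightarrow> ('k, ('v list \<Rightarrow>\<^sub>0 'k) set) comprelie_struct" where
  "T_plus scale f = (T scale f)
     \<lparr>carrier := {p. [] \<notin> Poly_Mapping.keys p} // tensor_rel scale\<rparr>"

definition letter :: "('k::field \<Rightarrow> 'v::ab_group_add \<Rightarrow> 'v) \<Rightarrow> 'v \<Rightarrow> ('v list \<Rightarrow>\<^sub>0 'k) set" where
  "letter scale v = tensor_rel scale `` {word [v]}"

section \<open>Codimension\<close>

text \<open>The codimension of a subspace \<open>W\<close> is the dimension of the quotient by \<open>W\<close>: the supremum
  of the sizes of the finite sets of vectors whose classes modulo \<open>W\<close> are linearly independent.\<close>

definition independent_mod :: "('k::field \<Rightarrow> 'v::ab_group_add \<Rightarrow> 'v) \<Rightarrow> 'v set \<Rightarrow> 'v set \<Rightarrow> bool" where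
  "independent_mod scale W B \<longleftrightarrow>
     (\<forall>c. (\<Sum>b\<in>B. scale (c b) b) \<in> W \<longrightarrow> (\<forall>b\<in>B. c b = 0))"

definition codim :: "('k::field \<Rightarrow> 'v::ab_group_add \<Rightarrow> 'v) \<Rightarrow> 'v set \<Rightarrow> enat" where
  "codim scale W = (SUP B\<in>{B. finite B \<and> independent_mod scale W B}. enat (card B))"

section \<open>Universal properties of the free algebras\<close>

lemma lift1_class:
  assumes "equiv UNIV R" "\<And>a b. (a, b) \<in> R \<Longrightarrow> (h a, h b) \<in> R"
  shows "lift1 R h (R `` {a}) = R `` {h a}"
  unfolding lift1_def
  by (rule UN_equiv_class[OF assms(1)])
     (auto intro!: congruentI equiv_class_eq[OF assms(1)] assms(2))

lemma lift2_class:
  assumes "equiv UNIV R"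
    "\<And>a a' b b'. (a, a') \<in> R \<Longrightarrow> (b, b') \<in> R \<Longrightarrow> (h a b, h a' b') \<in> R"
  shows "lift2 R h (R `` {a}) (R `` {b}) = R `` {h a b}"
  unfolding lift2_def
  by (rule UN_equiv_class2[OF assms(1) assms(1)])
     (auto intro!: congruent2I' equiv_class_eq[OF assms(1)] assms(2))

lemma equiv_pl_rel: "equiv UNIV (pl_rel scale)"
  by (rule equivI) (auto simp: pl_rel_def intro: refl_onI symI transI pl_refl pl_sym pl_trans)

lemma equiv_cpl_rel: "equiv UNIV (cpl_rel scale)"
  by (rule equivI) (auto simp: cpl_rel_def intro: refl_onI symI transI cpl_refl cpl_sym cpl_trans)

lemma pl_class_eq: "pl_rel scale `` {s} = pl_rel scale `` {t} \<longleftrightarrow> pl_eq scale s t"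
  using eq_equiv_class_iff[OF equiv_pl_rel] by (auto simp: pl_rel_def)

lemma cpl_class_eq: "cpl_rel scale `` {s} = cpl_rel scale `` {t} \<longleftrightarrow> cpl_eq scale s t"
  using eq_equiv_class_iff[OF equiv_cpl_rel] by (auto simp: cpl_rel_def)

lemma Prelie_class [simp]:
  "zero (Prelie scale) = pl_rel scale `` {PZero}"
  "add (Prelie scale) (pl_rel scale `` {s}) (pl_rel scale `` {t}) = pl_rel scale `` {PAdd s t}"
  "smult (Prelie scale) c (pl_rel scale `` {s}) = pl_rel scale `` {PScale c s}"
  "pre (Prelie scale) (pl_rel scale `` {s}) (pl_rel scale `` {t}) = pl_rel scale `` {PPre s t}"
  unfolding Prelie_def prelie_struct.simps
  by (rule refl, (intro lift1_class lift2_class equiv_pl_rel;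
      auto simp: pl_rel_def intro: pl_cong_add pl_cong_scale pl_cong_pre)+)

lemma ComPrelie_class [simp]:
  "zero (ComPrelie scale) = cpl_rel scale `` {CZero}"
  "add (ComPrelie scale) (cpl_rel scale `` {s}) (cpl_rel scale `` {t}) = cpl_rel scale `` {CAdd s t}"
  "smult (ComPrelie scale) c (cpl_rel scale `` {s}) = cpl_rel scale `` {CScale c s}"
  "pre (ComPrelie scale) (cpl_rel scale `` {s}) (cpl_rel scale `` {t}) = cpl_rel scale `` {CPre s t}"
  "shuf (ComPrelie scale) (cpl_rel scale `` {s}) (cpl_rel scale `` {t}) = cpl_rel scale `` {CSh s t}"
  unfolding ComPrelie_def prelie_struct.simps comprelie_struct.simps
  by (rule refl, (intro lift1_class lift2_class equiv_cpl_rel;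
      auto simp: cpl_rel_def intro: cpl_cong_add cpl_cong_scale cpl_cong_pre cpl_cong_sh)+)

lemma carrier_Prelie: "carrier (Prelie scale) = range (\<lambda>s. pl_rel scale `` {s})"
  by (auto simp: Prelie_def quotient_def)

lemma carrier_ComPrelie: "carrier (ComPrelie scale) = range (\<lambda>s. cpl_rel scale `` {s})"
  by (auto simp: ComPrelie_def quotient_def)

lemma class_in_carrier [simp]:
  "pl_rel scale `` {s} \<in> carrier (Prelie scale)"
  "cpl_rel scale `` {s'} \<in> carrier (ComPrelie scale)"
  by (auto simp: carrier_Prelie carrier_ComPrelie)

lemma carrier_cases:
  "\<lbrakk>X \<in> carrier (Prelie scale); \<And>s. X = pl_rel scale `` {s} \<Longrightarrow> P\<rbrakk> \<Longrightarrow> P"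
  "\<lbrakk>Y \<in> carrier (ComPrelie scale); \<And>s. Y = cpl_rel scale `` {s} \<Longrightarrow> P\<rbrakk> \<Longrightarrow> P"
  by (auto simp: carrier_Prelie carrier_ComPrelie)

lemma prelie_algebra_Prelie: "prelie_algebra (Prelie scale)"
  by (rule prelie_algebra.intro; (elim carrier_cases)?; hypsubst?;
      simp only: Prelie_class class_in_carrier subtract_def pl_class_eq;
      rule pl_eq.intros(9-21))

lemma comprelie_algebra_ComPrelie: "comprelie_algebra (ComPrelie scale)"
  by (rule comprelie_algebra.intro; rule prelie_algebra.intro comprelie_algebra_axioms.intro;
      (elim carrier_cases)?; hypsubst?;
      simp only: ComPrelie_class class_in_carrier subtract_def cpl_class_eq;
      rule cpl_eq.intros(10-27))

lemma linear_into_pl_gen: "linear_into scale (Prelie scale) (pl_gen scale)"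
  by (simp add: linear_into_def pl_gen_def pl_class_eq pl_gen_add pl_gen_scale)

lemma linear_into_cpl_gen: "linear_into scale (ComPrelie scale) (cpl_gen scale)"
  by (simp add: linear_into_def cpl_gen_def cpl_class_eq cpl_gen_add cpl_gen_scale)

primrec pl_eval :: "('k, 'a, 'm) prelie_struct_scheme \<Rightarrow> ('v \<Rightarrow> 'a) \<Rightarrow> ('k, 'v) plterm \<Rightarrow> 'a" where
  "pl_eval A g (PGen v) = g v"
| "pl_eval A g PZero = zero A"
| "pl_eval A g (PAdd s t) = add A (pl_eval A g s) (pl_eval A g t)"
| "pl_eval A g (PScale c s) = smult A c (pl_eval A g s)"
| "pl_eval A g (PPre s t) = pre A (pl_eval A g s) (pl_eval A g t)"

primrec cpl_eval :: "('k, 'a, 'm) comprelie_struct_scheme \<Rightarrow> ('v \<Rightarrow> 'a) \<Rightarrow> ('k, 'v) cplterm \<Rightarrow> 'a" where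
  "cpl_eval A g (CGen v) = g v"
| "cpl_eval A g CZero = zero A"
| "cpl_eval A g (CAdd s t) = add A (cpl_eval A g s) (cpl_eval A g t)"
| "cpl_eval A g (CScale c s) = smult A c (cpl_eval A g s)"
| "cpl_eval A g (CPre s t) = pre A (cpl_eval A g s) (cpl_eval A g t)"
| "cpl_eval A g (CSh s t) = shuf A (cpl_eval A g s) (cpl_eval A g t)"

lemma pl_eval_closed:
  assumes "prelie_algebra A" "linear_into scale A g"
  shows "pl_eval A g s \<in> carrier A"
proof -
  interpret prelie_algebra A by fact
  show ?thesis using assms(2)
    by (induction s) (auto simp: linear_into_def zero_closed add_closed smult_closed pre_closed)
qed

lemma cpl_eval_closed:
  assumes "comprelie_algebra A" "linear_into scale A g"
  shows "cpl_eval A g s \<in> carrier A"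
proof -
  interpret comprelie_algebra A by fact
  show ?thesis using assms(2)
    by (induction s)
       (auto simp: linear_into_def zero_closed add_closed smult_closed pre_closed shuf_closed)
qed

lemma pl_eval_cong:
  assumes "prelie_algebra A" "linear_into scale A g" "pl_eq scale s t"
  shows "pl_eval A g s = pl_eval A g t"
proof -
  interpret prelie_algebra A by fact
  note cl = pl_eval_closed[OF assms(1,2)]
  show ?thesis using assms(3)
  proof induction
    case (pl_add_comm s t) then show ?case by (simp add: add_comm cl)
  next
    case (pl_prelie s t u) then show ?case using prelie[OF cl cl cl] by (simp add: subtract_def)
  qed (use assms(2) in \<open>simp_all add: cl linear_into_def add_assoc add_zero add_uminus smult_add
        add_smult smult_smult smult_one pre_add_left pre_add_right pre_smult_left pre_smult_right\<close>)
qed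

lemma cpl_eval_cong:
  assumes "comprelie_algebra A" "linear_into scale A g" "cpl_eq scale s t"
  shows "cpl_eval A g s = cpl_eval A g t"
proof -
  interpret comprelie_algebra A by fact
  note cl = cpl_eval_closed[OF assms(1,2)]
  show ?thesis using assms(3)
  proof induction
    case (cpl_add_comm s t) then show ?case by (simp add: add_comm cl)
  next
    case (cpl_sh_comm s t) then show ?case by (simp add: shuf_comm cl)
  next
    case (cpl_prelie s t u) then show ?case using prelie[OF cl cl cl] by (simp add: subtract_def)
  qed (use assms(2) in \<open>simp_all add: cl linear_into_def add_assoc add_zero add_uminus smult_add
        add_smult smult_smult smult_one pre_add_left pre_add_right pre_smult_left pre_smult_right
        shuf_add_left shuf_smult_left shuf_assoc leibniz\<close>)
qed

theorem Prelie_universal: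
  fixes A :: "('k::field, 'a, 'm) prelie_struct_scheme" and scale :: "'k \<Rightarrow> 'v::ab_group_add \<Rightarrow> 'v"
  assumes A: "prelie_algebra A" and g: "linear_into scale A g"
  shows "\<exists>\<phi>\<in>prelie_hom (Prelie scale) A. \<forall>v. \<phi> (pl_gen scale v) = g v"
    and "\<lbrakk>\<phi> \<in> prelie_hom (Prelie scale) A; \<psi> \<in> prelie_hom (Prelie scale) A;
      \<forall>v. \<phi> (pl_gen scale v) = \<psi> (pl_gen scale v); X \<in> carrier (Prelie scale)\<rbrakk> \<Longrightarrow> \<phi> X = \<psi> X"
proof -
  define \<phi> where "\<phi> X = pl_eval A g (SOME s. s \<in> X)" for X
  have \<phi>: "\<phi> (pl_rel scale `` {s}) = pl_eval A g s" for s
  proof -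
    have "s \<in> pl_rel scale `` {s}" by (simp add: pl_rel_def pl_refl)
    then have "(SOME t. t \<in> pl_rel scale `` {s}) \<in> pl_rel scale `` {s}" by (rule someI)
    then show ?thesis using pl_eval_cong[OF A g] by (auto simp: \<phi>_def pl_rel_def)
  qed
  show "\<exists>\<phi>\<in>prelie_hom (Prelie scale) A. \<forall>v. \<phi> (pl_gen scale v) = g v"
    by (rule bexI[of _ \<phi>])
       (auto simp: \<phi> pl_gen_def prelie_hom_def carrier_Prelie pl_eval_closed[OF A g])
next
  assume h: "\<phi> \<in> prelie_hom (Prelie scale) A" "\<psi> \<in> prelie_hom (Prelie scale) A"
    and e: "\<forall>v. \<phi> (pl_gen scale v) = \<psi> (pl_gen scale v)" and X: "X \<in> carrier (Prelie scale)"
  interpret A: prelie_algebra A by fact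
  let ?c = "\<lambda>s. pl_rel scale `` {s}"
  have hom: "\<chi> (?c (PAdd s t)) = add A (\<chi> (?c s)) (\<chi> (?c t))"
      "\<chi> (?c (PScale c s)) = smult A c (\<chi> (?c s))"
      "\<chi> (?c (PPre s t)) = pre A (\<chi> (?c s)) (\<chi> (?c t))"
      "\<chi> (?c s) \<in> carrier A"
    if "\<chi> \<in> prelie_hom (Prelie scale) A" for \<chi> s t c
    using that by (auto simp: prelie_hom_def carrier_Prelie simp flip: Prelie_class)
  have z: "\<chi> (?c PZero) = zero A" if "\<chi> \<in> prelie_hom (Prelie scale) A" for \<chi>
  proof -
    have "?c PZero = ?c (PAdd PZero (PScale (- 1) PZero))"
      by (simp add: pl_class_eq pl_sym pl_add_uminus)
    then show ?thesis using A.add_uminus hom[OF that] by metis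
  qed
  have "\<phi> (?c s) = \<psi> (?c s)" for s
    using e by (induction s) (auto simp: pl_gen_def hom[OF h(1)] hom[OF h(2)] z[OF h(1)] z[OF h(2)])
  then show "\<phi> X = \<psi> X" using X by (auto simp: carrier_Prelie)
qed

theorem ComPrelie_universal:
  fixes A :: "('k::field, 'a, 'm) comprelie_struct_scheme"
    and scale :: "'k \<Rightarrow> 'v::ab_group_add \<Rightarrow> 'v"
  assumes A: "comprelie_algebra A" and g: "linear_into scale A g"
  shows "\<exists>\<phi>\<in>comprelie_hom (ComPrelie scale) A. \<forall>v. \<phi> (cpl_gen scale v) = g v"
    and "\<lbrakk>\<phi> \<in> comprelie_hom (ComPrelie scale) A; \<psi> \<in> comprelie_hom (ComPrelie scale) A;
      \<forall>v. \<phi> (cpl_gen scale v) = \<psi> (cpl_gen scale v); X \<in> carrier (ComPrelie scale)\<rbrakk>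
      \<Longrightarrow> \<phi> X = \<psi> X"
proof -
  define \<phi> where "\<phi> X = cpl_eval A g (SOME s. s \<in> X)" for X
  have \<phi>: "\<phi> (cpl_rel scale `` {s}) = cpl_eval A g s" for s
  proof -
    have "s \<in> cpl_rel scale `` {s}" by (simp add: cpl_rel_def cpl_refl)
    then have "(SOME t. t \<in> cpl_rel scale `` {s}) \<in> cpl_rel scale `` {s}" by (rule someI)
    then show ?thesis using cpl_eval_cong[OF A g] by (auto simp: \<phi>_def cpl_rel_def)
  qed
  show "\<exists>\<phi>\<in>comprelie_hom (ComPrelie scale) A. \<forall>v. \<phi> (cpl_gen scale v) = g v"
    by (rule bexI[of _ \<phi>])
       (auto simp: \<phi> cpl_gen_def prelie_hom_def comprelie_hom_def carrier_ComPrelie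
         cpl_eval_closed[OF A g])
next
  assume h: "\<phi> \<in> comprelie_hom (ComPrelie scale) A" "\<psi> \<in> comprelie_hom (ComPrelie scale) A"
    and e: "\<forall>v. \<phi> (cpl_gen scale v) = \<psi> (cpl_gen scale v)" and X: "X \<in> carrier (ComPrelie scale)"
  interpret A: comprelie_algebra A by fact
  let ?c = "\<lambda>s. cpl_rel scale `` {s}"
  have hom: "\<chi> (?c (CAdd s t)) = add A (\<chi> (?c s)) (\<chi> (?c t))"
      "\<chi> (?c (CScale c s)) = smult A c (\<chi> (?c s))"
      "\<chi> (?c (CPre s t)) = pre A (\<chi> (?c s)) (\<chi> (?c t))"
      "\<chi> (?c (CSh s t)) = shuf A (\<chi> (?c s)) (\<chi> (?c t))"
      "\<chi> (?c s) \<in> carrier A"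
    if "\<chi> \<in> comprelie_hom (ComPrelie scale) A" for \<chi> s t c
    using that
    by (auto simp: prelie_hom_def comprelie_hom_def carrier_ComPrelie simp flip: ComPrelie_class)
  have z: "\<chi> (?c CZero) = zero A" if "\<chi> \<in> comprelie_hom (ComPrelie scale) A" for \<chi>
  proof -
    have "?c CZero = ?c (CAdd CZero (CScale (- 1) CZero))"
      by (simp add: cpl_class_eq cpl_sym cpl_add_uminus)
    then show ?thesis using A.add_uminus hom[OF that] by metis
  qed
  have "\<phi> (?c s) = \<psi> (?c s)" for s
    using e by (induction s) (auto simp: cpl_gen_def hom[OF h(1)] hom[OF h(2)] z[OF h(1)] z[OF h(2)])
  then show "\<phi> X = \<psi> X" using X by (auto simp: carrier_ComPrelie)
qed

section \<open>\<open>T(V,f)\<close> and \<open>T\<^sub>+(V,f)\<close> are Com-Pre-Lie algebras\<close>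

lemma lookup_pm_scale [simp]: "Poly_Mapping.lookup (pm_scale c p) x = c * Poly_Mapping.lookup p x"
  by (simp add: pm_scale_def Poly_Mapping.map.rep_eq when_def)

lemma vector_space_pm_scale: "vector_space (pm_scale :: 'k::field \<Rightarrow> ('a \<Rightarrow>\<^sub>0 'k) \<Rightarrow> _)"
  by unfold_locales (auto intro!: poly_mapping_eqI simp: lookup_add algebra_simps)

interpretation pm: vector_space "pm_scale :: 'k::field \<Rightarrow> ('a \<Rightarrow>\<^sub>0 'k) \<Rightarrow> _"
  by (rule vector_space_pm_scale)

abbreviation pm_linear :: "(('a \<Rightarrow>\<^sub>0 'k::field) \<Rightarrow> ('b \<Rightarrow>\<^sub>0 'k)) \<Rightarrow> bool" where
  "pm_linear \<equiv> Vector_Spaces.linear pm_scale pm_scale"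

lemma pm_linearI:
  "\<lbrakk>\<And>p q. F (p + q) = F p + F q; \<And>c p. F (pm_scale c p) = pm_scale c (F p)\<rbrakk> \<Longrightarrow> pm_linear F"
  by (intro Vector_Spaces.linear.intro vector_space_pm_scale module_hom.intro
      module_hom_axioms.intro pm.module_axioms)

lemma linear_ext_superset:
  assumes "finite S" "Poly_Mapping.keys p \<subseteq> S"
  shows "linear_ext h p = (\<Sum>a\<in>S. pm_scale (Poly_Mapping.lookup p a) (h a))"
  unfolding linear_ext_def using assms
  by (intro sum.mono_neutral_left) (auto simp: in_keys_iff)

lemma linear_ext_add [simp]: "linear_ext h (p + q) = linear_ext h p + linear_ext h q"
proof -
  let ?S = "Poly_Mapping.keys p \<union> Poly_Mapping.keys q"
  have "Poly_Mapping.keys (p + q) \<subseteq> ?S" by (rule keys_add)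
  then show ?thesis
    by (simp add: linear_ext_superset[of ?S] lookup_add pm.scale_left_distrib sum.distrib)
qed

lemma linear_ext_scale [simp]: "linear_ext h (pm_scale c p) = pm_scale c (linear_ext h p)"
proof -
  have "Poly_Mapping.keys (pm_scale c p) \<subseteq> Poly_Mapping.keys p" by (auto simp: in_keys_iff)
  then show ?thesis
    by (simp add: linear_ext_superset[of "Poly_Mapping.keys p"] pm.scale_sum_right)
qed

lemma linear_linear_ext: "pm_linear (linear_ext h)"
  by (rule pm_linearI) simp_all

lemma linear_ext_zero [simp]: "linear_ext h 0 = 0"
  by (simp add: linear_ext_def)

lemma linear_ext_minus [simp]: "linear_ext h (p - q) = linear_ext h p - linear_ext h q"
  by (metis add_diff_cancel linear_ext_add diff_add_cancel)

lemma linear_ext_single [simp]: "linear_ext h (Poly_Mapping.single a 1) = h a"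
  by (simp add: linear_ext_def)

lemma linear_ext_add_fun: "linear_ext (\<lambda>a. h a + h' a) p = linear_ext h p + linear_ext h' p"
  by (simp add: linear_ext_def pm.scale_right_distrib sum.distrib)

lemma linear_ext_scale_fun: "linear_ext (\<lambda>a. pm_scale c (h a)) p = pm_scale c (linear_ext h p)"
  by (simp add: linear_ext_def pm.scale_sum_right mult.commute)

lemma pm_expand: "p = linear_ext (\<lambda>a. Poly_Mapping.single a 1) p"
  by (rule poly_mapping_eqI)
     (simp add: linear_ext_def lookup_sum lookup_single when_def in_keys_iff if_distrib cong: if_cong)

lemma pm_induct [case_names single add scale]:
  assumes "\<And>a. P (Poly_Mapping.single a 1)" "\<And>p q. P p \<Longrightarrow> P q \<Longrightarrow> P (p + q)"
    "\<And>c p. P p \<Longrightarrow> P (pm_scale c p)"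
  shows "P (p :: 'a \<Rightarrow>\<^sub>0 'k::field)"
proof -
  have 0: "P 0" using assms(3)[OF assms(1), of 0] by simp
  have "finite S \<Longrightarrow> P (\<Sum>a\<in>S. pm_scale (Poly_Mapping.lookup p a) (Poly_Mapping.single a 1))" for S
    by (induction S rule: finite_induct) (auto intro: 0 assms)
  then show ?thesis
    by (subst pm_expand) (simp add: linear_ext_def)
qed

abbreviation raw_sh :: "('v list \<Rightarrow>\<^sub>0 'k::field) \<Rightarrow> ('v list \<Rightarrow>\<^sub>0 'k) \<Rightarrow> ('v list \<Rightarrow>\<^sub>0 'k)" where
  "raw_sh \<equiv> bilinear_ext shuffle_word"

abbreviation raw_pre ::
  "('v \<Rightarrow> 'v) \<Rightarrow> ('v list \<Rightarrow>\<^sub>0 'k::field) \<Rightarrow> ('v list \<Rightarrow>\<^sub>0 'k) \<Rightarrow> ('v list \<Rightarrow>\<^sub>0 'k)" where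
  "raw_pre f \<equiv> bilinear_ext (pre_word f)"

lemma bilinear_ext_simps [simp]:
  "bilinear_ext h (p + p') q = bilinear_ext h p q + bilinear_ext h p' q"
  "bilinear_ext h p (q + q') = bilinear_ext h p q + bilinear_ext h p q'"
  "bilinear_ext h (pm_scale c p) q = pm_scale c (bilinear_ext h p q)"
  "bilinear_ext h p (pm_scale c q) = pm_scale c (bilinear_ext h p q)"
  "bilinear_ext h (Poly_Mapping.single a 1) (Poly_Mapping.single b 1) = h a b"
  "bilinear_ext h 0 q = 0" "bilinear_ext h p 0 = 0"
  by (simp_all add: bilinear_ext_def linear_ext_add_fun linear_ext_scale_fun, simp add: linear_ext_def)

lemma bilinear_ext_minus [simp]:
  "bilinear_ext h (p - p') q = bilinear_ext h p q - bilinear_ext h p' q"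
  "bilinear_ext h p (q - q') = bilinear_ext h p q - bilinear_ext h p q'"
  by (metis add_diff_cancel bilinear_ext_simps(1) diff_add_cancel,
      metis add_diff_cancel bilinear_ext_simps(2) diff_add_cancel)

lemma prepend_simps [simp]:
  "prepend x (p + q) = prepend x p + prepend x q"
  "prepend x (p - q) = prepend x p - prepend x q"
  "prepend x (pm_scale c p) = pm_scale c (prepend x p)"
  "prepend x (word w) = word (x # w)"
  "prepend x 0 = 0"
  by (simp_all add: prepend_def)

lemma shuffle_word_Nil2 [simp]: "shuffle_word u [] = word u"
  by (cases u) simp_all

lemma raw_sh_Nil [simp]: "raw_sh (word []) p = p" "raw_sh p (word []) = p"
  by (induction p rule: pm_induct) simp_all

lemma raw_sh_prepend:
  "raw_sh (prepend x p) (prepend y q) =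
     prepend x (raw_sh p (prepend y q)) + prepend y (raw_sh (prepend x p) q)"
proof (induction p rule: pm_induct)
  case (single u)
  show ?case
    by (induction q rule: pm_induct) (simp_all add: pm.scale_right_distrib)
qed (simp_all add: pm.scale_right_distrib)

lemma raw_pre_prepend:
  "raw_pre f (prepend x p) q = prepend x (raw_pre f p q) + prepend (f x) (raw_sh p q)"
proof (induction p rule: pm_induct)
  case (single u)
  show ?case
    by (induction q rule: pm_induct) (simp_all add: pm.scale_right_distrib)
qed (simp_all add: pm.scale_right_distrib)

lemma raw_pre_Nil [simp]: "raw_pre f (word []) p = 0"
  by (induction p rule: pm_induct) simp_all

lemma shuffle_word_comm: "shuffle_word u v = shuffle_word v u"
  by (induction u v rule: shuffle_word.induct) (simp_all add: add.commute)

lemma raw_sh_comm: "raw_sh p q = raw_sh q p"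
proof (induction p rule: pm_induct)
  case (single u)
  show ?case
    by (induction q rule: pm_induct) (simp_all add: shuffle_word_comm)
qed simp_all

lemma trilinear_eqI:
  fixes F G :: "('a \<Rightarrow>\<^sub>0 'k::field) \<Rightarrow> ('b \<Rightarrow>\<^sub>0 'k) \<Rightarrow> ('c \<Rightarrow>\<^sub>0 'k) \<Rightarrow> ('d \<Rightarrow>\<^sub>0 'k)"
  assumes "\<And>q r. pm_linear (\<lambda>p. F p q r)" "\<And>p r. pm_linear (\<lambda>q. F p q r)"
    "\<And>p q. pm_linear (F p q)"
    "\<And>q r. pm_linear (\<lambda>p. G p q r)" "\<And>p r. pm_linear (\<lambda>q. G p q r)"
    "\<And>p q. pm_linear (G p q)"
    "\<And>a b c. F (Poly_Mapping.single a 1) (Poly_Mapping.single b 1) (Poly_Mapping.single c 1)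
      = G (Poly_Mapping.single a 1) (Poly_Mapping.single b 1) (Poly_Mapping.single c 1)"
  shows "F p q r = G p q r"
proof -
  note a = assms(1-6)[THEN linear_iff_module_hom[THEN iffD1], THEN module_hom.add]
  note s = assms(1-6)[THEN linear_iff_module_hom[THEN iffD1], THEN module_hom.scale]
  have 1: "F (Poly_Mapping.single u 1) (Poly_Mapping.single v 1) r =
      G (Poly_Mapping.single u 1) (Poly_Mapping.single v 1) r" for u v
    by (induction r rule: pm_induct) (simp_all add: a s assms(7))
  have 2: "F (Poly_Mapping.single u 1) q r = G (Poly_Mapping.single u 1) q r" for u
    by (induction q rule: pm_induct) (simp_all add: a s 1)
  show ?thesis
    by (induction p rule: pm_induct) (simp_all add: a s 2)
qed

lemma raw_sh_assoc_words:
  "raw_sh (raw_sh (word u) (word v)) (word w) = raw_sh (word u) (raw_sh (word v) (word w))"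
proof (induction "length u + length v + length w" arbitrary: u v w rule: less_induct)
  case less
  show ?case
  proof (cases "u = [] \<or> v = [] \<or> w = []")
    case True then show ?thesis by (auto simp del: bilinear_ext_simps(5))
  next
    case False
    then obtain x u' y v' z w' where e: "u = x # u'" "v = y # v'" "w = z # w'"
      by (metis list.exhaust)
    note IH = less(1)[of u' v w] less(1)[of u v' w] less(1)[of u v w']
    have p: "word u = prepend x (word u')" "word v = prepend y (word v')"
      "word w = prepend z (word w')" using e by simp_all
    show ?thesis using IH unfolding e(1-3) unfolding p[unfolded e]
      by (simp add: raw_sh_prepend del: bilinear_ext_simps(5) prepend_simps(4))
         (simp add: raw_sh_prepend algebra_simps flip: prepend_simps(1) del: bilinear_ext_simps(5) prepend_simps(4))
  qed
qed

lemma raw_sh_assoc: "raw_sh (raw_sh p q) r = raw_sh p (raw_sh q r)"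
  by (rule trilinear_eqI[of "\<lambda>p q r. raw_sh (raw_sh p q) r" "\<lambda>p q r. raw_sh p (raw_sh q r)"];
      (rule raw_sh_assoc_words | rule pm_linearI; simp))

lemma raw_sh_left_comm: "raw_sh p (raw_sh q r) = raw_sh q (raw_sh p r)"
  by (metis raw_sh_assoc raw_sh_comm)

lemma raw_leibniz_words:
  "raw_pre f (raw_sh (word u) (word v)) r =
     raw_sh (raw_pre f (word u) r) (word v) + raw_sh (word u) (raw_pre f (word v) r)"
proof (induction "length u + length v" arbitrary: u v rule: less_induct)
  case less
  show ?case
  proof (cases "u = [] \<or> v = []")
    case True then show ?thesis by (auto simp del: bilinear_ext_simps(5))
  next
    case False
    then obtain x u' y v' where e: "u = x # u'" "v = y # v'"
      by (metis list.exhaust)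
    note IH = less(1)[of u' v] less(1)[of u v']
    have p: "word u = prepend x (word u')" "word v = prepend y (word v')" using e by simp_all
    have s1: "raw_sh (prepend (f x) p) (prepend y q) =
      prepend (f x) (raw_sh p (prepend y q)) + prepend y (raw_sh (prepend (f x) p) q)" for p q
      by (rule raw_sh_prepend)
    show ?thesis using IH unfolding e unfolding p[unfolded e]
      by (simp add: raw_sh_prepend raw_pre_prepend del: bilinear_ext_simps(5) prepend_simps(4))
         (simp add: raw_sh_assoc raw_sh_left_comm raw_sh_comm[of _ r] algebra_simps
           del: bilinear_ext_simps(5) prepend_simps(4))
  qed
qed

lemma raw_leibniz: "raw_pre f (raw_sh p q) r = raw_sh (raw_pre f p r) q + raw_sh p (raw_pre f q r)"
  by (rule trilinear_eqI[of "\<lambda>p q r. raw_pre f (raw_sh p q) r"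
      "\<lambda>p q r. raw_sh (raw_pre f p r) q + raw_sh p (raw_pre f q r)"];
      (rule raw_leibniz_words | rule pm_linearI; simp add: pm.scale_right_distrib))

lemma raw_prelie_words:
  "raw_pre f (raw_pre f (word u) q) r - raw_pre f (word u) (raw_pre f q r) =
   raw_pre f (raw_pre f (word u) r) q - raw_pre f (word u) (raw_pre f r q)"
proof (induction u)
  case Nil then show ?case by (simp del: bilinear_ext_simps(5))
next
  case (Cons x u)
  have p: "word (x # u) = prepend x (word u)" by simp
  let ?P = "\<lambda>q r. raw_pre f (raw_pre f (word u) q) r - raw_pre f (word u) (raw_pre f q r)"
  have E: "raw_pre f (raw_pre f (word (x # u)) q) r - raw_pre f (word (x # u)) (raw_pre f q r) =
    prepend x (?P q r) +
    prepend (f x) (raw_sh (raw_pre f (word u) q) r + raw_sh (raw_pre f (word u) r) q) +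
    prepend (f (f x)) (raw_sh (raw_sh (word u) q) r)" for q r
    unfolding p by (simp add: raw_pre_prepend raw_leibniz algebra_simps
        del: bilinear_ext_simps(5) prepend_simps(4))
  show ?case unfolding E[of q r] E[of r q] Cons.IH
    by (simp add: raw_sh_assoc raw_sh_comm[of q r] add.commute
        del: bilinear_ext_simps prepend_simps)
qed

lemma raw_prelie:
  "raw_pre f (raw_pre f p q) r - raw_pre f p (raw_pre f q r) =
   raw_pre f (raw_pre f p r) q - raw_pre f p (raw_pre f r q)"
proof (induction p rule: pm_induct)
  case (single a) show ?case by (rule raw_prelie_words)
next
  case (add p p') then show ?case by (simp add: algebra_simps)
next
  case (scale c p) then show ?case by (simp flip: pm.scale_right_diff_distrib)
qed

lemma keys_raw_sh:
  fixes p q :: "'v list \<Rightarrow>\<^sub>0 'k::field"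
  assumes "[] \<notin> Poly_Mapping.keys p"
  shows "[] \<notin> Poly_Mapping.keys (raw_sh p q)"
proof -
  have pr: "Poly_Mapping.lookup (prepend x r) [] = 0" for x :: 'v and r :: "'v list \<Rightarrow>\<^sub>0 'k"
    by (induction r rule: pm_induct) (simp_all add: lookup_add lookup_single)
  have w: "Poly_Mapping.lookup (shuffle_word u v :: 'v list \<Rightarrow>\<^sub>0 'k) [] =
      Poly_Mapping.lookup (word u) [] * Poly_Mapping.lookup (word v) []" for u v
    by (cases u; cases v) (simp_all add: pr lookup_add lookup_single)
  have u: "Poly_Mapping.lookup (raw_sh (word u) q) [] =
      Poly_Mapping.lookup (word u) [] * Poly_Mapping.lookup q []" for u
    by (induction q rule: pm_induct) (simp_all add: w lookup_add algebra_simps)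
  have "Poly_Mapping.lookup (raw_sh p q) [] =
      Poly_Mapping.lookup p [] * Poly_Mapping.lookup q []"
    by (induction p rule: pm_induct) (simp_all add: u lookup_add algebra_simps)
  then show ?thesis using assms by (simp add: in_keys_iff)
qed

lemma keys_raw_pre:
  fixes p q :: "'v list \<Rightarrow>\<^sub>0 'k::field"
  shows "[] \<notin> Poly_Mapping.keys (raw_pre f p q)"
proof -
  have pr: "Poly_Mapping.lookup (prepend x r) [] = 0" for x :: 'v and r :: "'v list \<Rightarrow>\<^sub>0 'k"
    by (induction r rule: pm_induct) (simp_all add: lookup_add lookup_single)
  have w: "Poly_Mapping.lookup (pre_word f u v :: 'v list \<Rightarrow>\<^sub>0 'k) [] = 0" for u v
    by (cases u) (simp_all add: pr lookup_add)
  have u: "Poly_Mapping.lookup (raw_pre f (word u) q) [] = 0" for u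
    by (induction q rule: pm_induct) (simp_all add: w lookup_add)
  have "Poly_Mapping.lookup (raw_pre f p q) [] = 0"
    by (induction p rule: pm_induct) (simp_all add: u lookup_add)
  then show ?thesis by (simp add: in_keys_iff)
qed

lemma subspace_null: "pm.subspace (tensor_null scale)"
  by (simp add: tensor_null_def)

lemmas null_zero = pm.subspace_0[OF subspace_null]
lemmas null_add = pm.subspace_add[OF subspace_null]
lemmas null_diff = pm.subspace_diff[OF subspace_null]
lemmas null_scale = pm.subspace_scale[OF subspace_null]

definition lin_mod :: "('k::field \<Rightarrow> 'v::ab_group_add \<Rightarrow> 'v) \<Rightarrow> ('v \<Rightarrow> ('v list \<Rightarrow>\<^sub>0 'k)) \<Rightarrow> bool" where
  "lin_mod scale g \<longleftrightarrow> (\<forall>x y. g (x + y) - g x - g y \<in> tensor_null scale) \<and>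
     (\<forall>c x. g (scale c x) - pm_scale c (g x) \<in> tensor_null scale)"

lemma lin_mod_word: "lin_mod scale (\<lambda>x. word (u @ x # w))"
  unfolding lin_mod_def tensor_null_def by (blast intro: pm.span_base)

lemma lin_mod_add: "lin_mod scale g \<Longrightarrow> lin_mod scale h \<Longrightarrow> lin_mod scale (\<lambda>x. g x + h x)"
  unfolding lin_mod_def
proof (intro conjI allI; elim conjE)
  fix x y
  assume "\<forall>x y. g (x + y) - g x - g y \<in> tensor_null scale" "\<forall>x y. h (x + y) - h x - h y \<in> tensor_null scale"
  then show "g (x + y) + h (x + y) - (g x + h x) - (g y + h y) \<in> tensor_null scale"
    using null_add[of "g (x + y) - g x - g y" scale "h (x + y) - h x - h y"]
    by (simp add: algebra_simps)
next
  fix c x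
  assume "\<forall>c x. g (scale c x) - pm_scale c (g x) \<in> tensor_null scale"
    "\<forall>c x. h (scale c x) - pm_scale c (h x) \<in> tensor_null scale"
  then show "g (scale c x) + h (scale c x) - pm_scale c (g x + h x) \<in> tensor_null scale"
    using null_add[of "g (scale c x) - pm_scale c (g x)" scale "h (scale c x) - pm_scale c (h x)"]
    by (simp add: algebra_simps pm.scale_right_distrib)
qed

lemma lin_mod_scale: "lin_mod scale g \<Longrightarrow> lin_mod scale (\<lambda>x. pm_scale c (g x))"
  unfolding lin_mod_def
proof (intro conjI allI; elim conjE)
  fix x y
  assume "\<forall>x y. g (x + y) - g x - g y \<in> tensor_null scale"
  then show "pm_scale c (g (x + y)) - pm_scale c (g x) - pm_scale c (g y) \<in> tensor_null scale"
    using null_scale[of "g (x + y) - g x - g y" scale c] by (simp add: pm.scale_right_diff_distrib)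
next
  fix d x
  assume "\<forall>c x. g (scale c x) - pm_scale c (g x) \<in> tensor_null scale"
  then show "pm_scale c (g (scale d x)) - pm_scale d (pm_scale c (g x)) \<in> tensor_null scale"
    using null_scale[of "g (scale d x) - pm_scale d (g x)" scale c]
    by (simp add: pm.scale_right_diff_distrib mult.commute)
qed

lemma lin_mod_comp:
  assumes "Vector_Spaces.linear scale scale f" "lin_mod scale g"
  shows "lin_mod scale (\<lambda>x. g (f x))"
proof -
  interpret f: Vector_Spaces.linear scale scale f by fact
  show ?thesis using assms(2) by (simp add: lin_mod_def f.add f.scale)
qed

lemma null_image:
  assumes F: "pm_linear F" and g: "\<And>u w. lin_mod scale (\<lambda>x. F (word (u @ x # w)))"
    and p: "p \<in> tensor_null scale"
  shows "F p \<in> tensor_null scale"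
proof -
  interpret F: Vector_Spaces.linear pm_scale pm_scale F by fact
  show ?thesis using p unfolding tensor_null_def
  proof (rule pm.span_induct, fold tensor_null_def)
    show "pm.subspace {p. F p \<in> tensor_null scale}"
      using F.subspace_vimage[OF subspace_null] by (simp add: vimage_def)
  qed (use g in \<open>auto simp: lin_mod_def F.diff F.scale\<close>)
qed

lemma linear_prepend: "pm_linear (prepend x)"
  by (rule pm_linearI) simp_all

lemma null_prepend: "p \<in> tensor_null scale \<Longrightarrow> prepend z p \<in> tensor_null scale"
  by (rule null_image[OF linear_prepend])
     (use lin_mod_word[of _ "z # _"] in simp_all)

lemma lin_mod_prepend: "lin_mod scale g \<Longrightarrow> lin_mod scale (\<lambda>x. prepend z (g x))"
  using null_prepend[of "g _ - g _ - g _"] null_prepend[of "g _ - pm_scale _ (g _)"]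
  by (auto simp: lin_mod_def)

lemma lin_mod_prepend_arg: "lin_mod scale (\<lambda>x. prepend x p)"
proof (induction p rule: pm_induct)
  case (single w) show ?case using lin_mod_word[of _ "[]" w] by simp
qed (simp_all add: lin_mod_add lin_mod_scale)

lemma lin_mod_shuffle_word: "lin_mod scale (\<lambda>x. shuffle_word (u @ x # w) v)"
proof (induction "length u + length v" arbitrary: u v rule: less_induct)
  case less
  show ?case
  proof (cases v)
    case Nil then show ?thesis by (simp add: lin_mod_word)
  next
    case v: (Cons y v')
    show ?thesis
    proof (cases u)
      case Nil
      then show ?thesis using v less[of "[]" v']
        by (simp add: lin_mod_add lin_mod_prepend lin_mod_prepend_arg)
    next
      case (Cons z u')
      then show ?thesis using v less[of u' v] less[of u v']
        by (simp add: lin_mod_add lin_mod_prepend)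
    qed
  qed
qed

lemma lin_mod_raw_sh: "lin_mod scale (\<lambda>x. raw_sh (word (u @ x # w)) q)"
  by (induction q rule: pm_induct) (simp_all add: lin_mod_add lin_mod_scale lin_mod_shuffle_word)

lemma null_raw_sh:
  assumes "p \<in> tensor_null scale"
  shows "raw_sh p q \<in> tensor_null scale" "raw_sh q p \<in> tensor_null scale"
proof -
  show "raw_sh p q \<in> tensor_null scale"
    by (rule null_image[OF _ _ assms]) (auto intro: pm_linearI lin_mod_raw_sh)
  then show "raw_sh q p \<in> tensor_null scale" by (simp add: raw_sh_comm)
qed

lemma lin_mod_raw_pre:
  assumes "Vector_Spaces.linear scale scale f"
  shows "lin_mod scale (\<lambda>x. raw_pre f (word (u @ x # w)) q)"
proof (induction u)
  case Nil
  have "raw_pre f (word (x # w)) q = prepend x (raw_pre f (word w) q) + prepend (f x) (raw_sh (word w) q)"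
    for x by (simp flip: raw_pre_prepend)
  then show ?case
    by (simp add: lin_mod_add lin_mod_prepend_arg lin_mod_comp[OF assms lin_mod_prepend_arg])
next
  case (Cons z u)
  have "raw_pre f (word ((z # u) @ x # w)) q =
     prepend z (raw_pre f (word (u @ x # w)) q) + prepend (f z) (raw_sh (word (u @ x # w)) q)"
    for x by (simp flip: raw_pre_prepend)
  then show ?case
    by (simp add: lin_mod_add lin_mod_prepend lin_mod_raw_sh Cons)
qed

lemma null_raw_pre:
  assumes "Vector_Spaces.linear scale scale f" "p \<in> tensor_null scale"
  shows "raw_pre f p q \<in> tensor_null scale" "raw_pre f q p \<in> tensor_null scale"
proof -
  show "raw_pre f p q \<in> tensor_null scale"
    by (rule null_image[OF _ _ assms(2)]) (auto intro: pm_linearI lin_mod_raw_pre[OF assms(1)])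
  have w: "raw_pre f (word u) p \<in> tensor_null scale" for u
  proof (induction u)
    case Nil then show ?case by (simp add: null_zero)
  next
    case (Cons z u)
    have "raw_pre f (word (z # u)) p = prepend z (raw_pre f (word u) p) + prepend (f z) (raw_sh (word u) p)"
      by (simp flip: raw_pre_prepend)
    then show ?case by (simp add: null_add null_prepend null_raw_sh assms(2) Cons)
  qed
  show "raw_pre f q p \<in> tensor_null scale"
    by (induction q rule: pm_induct) (simp_all add: w null_add null_scale)
qed

lemma equiv_tensor_rel: "equiv UNIV (tensor_rel scale)"
proof (rule equivI)
  show "refl (tensor_rel scale)" by (auto simp: tensor_rel_def null_zero intro: refl_onI)
  show "sym (tensor_rel scale)"
    by (rule symI) (use pm.subspace_neg[OF subspace_null] in \<open>fastforce simp: tensor_rel_def\<close>)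
  show "trans (tensor_rel scale)"
    by (rule transI) (use null_add in \<open>fastforce simp: tensor_rel_def\<close>)
qed simp

lemma T_class [simp]:
  "zero (T scale f) = tensor_rel scale `` {0}"
  "add (T scale f) (tensor_rel scale `` {p}) (tensor_rel scale `` {q}) = tensor_rel scale `` {p + q}"
  "smult (T scale f) c (tensor_rel scale `` {p}) = tensor_rel scale `` {pm_scale c p}"
  "shuf (T scale f) (tensor_rel scale `` {p}) (tensor_rel scale `` {q}) = tensor_rel scale `` {raw_sh p q}"
proof -
  show "zero (T scale f) = tensor_rel scale `` {0}" by (simp add: T_def)
  show "add (T scale f) (tensor_rel scale `` {p}) (tensor_rel scale `` {q}) = tensor_rel scale `` {p + q}"
    unfolding T_def prelie_struct.simps
  proof (rule lift2_class[OF equiv_tensor_rel])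
    fix a a' b b'
    assume "(a, a') \<in> tensor_rel scale" "(b, b') \<in> tensor_rel scale"
    then show "(a + b, a' + b') \<in> tensor_rel scale"
      using null_add[of "a - a'" scale "b - b'"] by (simp add: tensor_rel_def algebra_simps)
  qed
  show "smult (T scale f) c (tensor_rel scale `` {p}) = tensor_rel scale `` {pm_scale c p}"
    unfolding T_def prelie_struct.simps
    by (rule lift1_class[OF equiv_tensor_rel])
       (use null_scale in \<open>auto simp: tensor_rel_def simp flip: pm.scale_right_diff_distrib\<close>)
  show "shuf (T scale f) (tensor_rel scale `` {p}) (tensor_rel scale `` {q}) = tensor_rel scale `` {raw_sh p q}"
    unfolding T_def prelie_struct.simps comprelie_struct.simps
  proof (rule lift2_class[OF equiv_tensor_rel])
    fix a a' b b'
    assume "(a, a') \<in> tensor_rel scale" "(b, b') \<in> tensor_rel scale"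
    then show "(raw_sh a b, raw_sh a' b') \<in> tensor_rel scale"
      using null_add[OF null_raw_sh(1)[of "a - a'" scale b] null_raw_sh(2)[of "b - b'" scale a']]
      by (simp add: tensor_rel_def)
  qed
qed

lemma T_pre_class [simp]:
  assumes "Vector_Spaces.linear scale scale f"
  shows "pre (T scale f) (tensor_rel scale `` {p}) (tensor_rel scale `` {q}) =
    tensor_rel scale `` {raw_pre f p q}"
  unfolding T_def prelie_struct.simps comprelie_struct.simps
proof (rule lift2_class[OF equiv_tensor_rel])
  fix a a' b b'
  assume "(a, a') \<in> tensor_rel scale" "(b, b') \<in> tensor_rel scale"
  then show "(raw_pre f a b, raw_pre f a' b') \<in> tensor_rel scale"
    using null_add[OF null_raw_pre(1)[OF assms, of "a - a'" b] null_raw_pre(2)[OF assms, of "b - b'" a']]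
    by (simp add: tensor_rel_def)
qed

lemma T_plus_ops [simp]:
  "zero (T_plus scale f) = zero (T scale f)" "add (T_plus scale f) = add (T scale f)"
  "smult (T_plus scale f) = smult (T scale f)" "pre (T_plus scale f) = pre (T scale f)"
  "shuf (T_plus scale f) = shuf (T scale f)"
  by (simp_all add: T_plus_def T_def)

lemma comprelie_algebra_quotient:
  fixes scale :: "'k::field \<Rightarrow> 'v::ab_group_add \<Rightarrow> 'v"
    and A :: "('k, ('v list \<Rightarrow>\<^sub>0 'k) set, 'm) comprelie_struct_scheme"
  assumes f: "Vector_Spaces.linear scale scale f"
    and A: "carrier A = S // tensor_rel scale" "zero A = zero (T scale f)"
      "add A = add (T scale f)" "smult A = smult (T scale f)" "pre A = pre (T scale f)"
      "shuf A = shuf (T scale f)"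
    and S: "0 \<in> S" "\<And>p q. p \<in> S \<Longrightarrow> q \<in> S \<Longrightarrow> p + q \<in> S" "\<And>c p. p \<in> S \<Longrightarrow> pm_scale c p \<in> S"
      "\<And>p q. p \<in> S \<Longrightarrow> q \<in> S \<Longrightarrow> raw_pre f p q \<in> S" "\<And>p q. p \<in> S \<Longrightarrow> q \<in> S \<Longrightarrow> raw_sh p q \<in> S"
  shows "comprelie_algebra A"
proof -
  have in_carrier: "tensor_rel scale `` {p} \<in> carrier A" if "p \<in> S" for p
    using that by (auto simp: A quotient_def)
  have cases: thesis
    if "X \<in> carrier A" "\<And>p. p \<in> S \<Longrightarrow> X = tensor_rel scale `` {p} \<Longrightarrow> thesis" for X thesis
    using that by (auto simp: A quotient_def)
  note ops = A(2-6) T_class T_pre_class[OF f]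
  have prelie: "raw_pre f (raw_pre f p q) r + pm_scale (- 1) (raw_pre f p (raw_pre f q r)) =
    raw_pre f (raw_pre f p r) q + pm_scale (- 1) (raw_pre f p (raw_pre f r q))" for p q r :: "'v list \<Rightarrow>\<^sub>0 'k"
    using raw_prelie[of f p q r] by simp
  show ?thesis
    by (rule comprelie_algebra.intro; rule prelie_algebra.intro comprelie_algebra_axioms.intro;
      (elim cases)?; hypsubst?; (simp only: ops subtract_def)?; (rule in_carrier)?;
      (rule arg_cong[where f = "\<lambda>p. tensor_rel scale `` {p}"])?; (rule prelie)?;
      (simp add: S algebra_simps pm.scale_right_distrib pm.scale_left_distrib
          raw_leibniz raw_sh_assoc raw_sh_left_comm raw_sh_comm; fail)?)
qed

theorem comprelie_algebra_T:
  assumes "Vector_Spaces.linear scale scale f"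
  shows "comprelie_algebra (T scale f)"
  by (rule comprelie_algebra_quotient[OF assms, where S = UNIV]) (simp_all add: T_def)

theorem comprelie_algebra_T_plus:
  assumes "Vector_Spaces.linear scale scale f"
  shows "comprelie_algebra (T_plus scale f)"
proof (rule comprelie_algebra_quotient[OF assms, where S = "{p. [] \<notin> Poly_Mapping.keys p}"])
  show "carrier (T_plus scale f) = {p. [] \<notin> Poly_Mapping.keys p} // tensor_rel scale"
    by (simp add: T_plus_def)
qed (auto simp: keys_raw_sh keys_raw_pre, auto simp: in_keys_iff lookup_add)

lemma linear_into_letter: "linear_into scale (T_plus scale f) (letter scale)"
proof -
  have "letter scale v \<in> carrier (T_plus scale f)" for v
    by (simp add: letter_def T_plus_def quotientI)
  moreover have "(word [v + w], word [v] + word [w]) \<in> tensor_rel scale"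
    and "(word [scale c v], pm_scale c (word [v])) \<in> tensor_rel scale" for c v w
    using lin_mod_word[of scale "[]" "[]"] by (simp_all add: lin_mod_def tensor_rel_def algebra_simps)
  ultimately show ?thesis
    by (simp add: linear_into_def letter_def equiv_class_eq[OF equiv_tensor_rel])
qed

text \<open>The morphisms to \<open>T\<^sub>+(V,f)\<close> extending the inclusion of letters exist; by the universal properties they are unique on the
  respective carriers.\<close>

theorem morphisms_exist:
  assumes f: "Vector_Spaces.linear scale scale f"
  shows "\<exists>\<phi>\<in>prelie_hom (Prelie scale) (T_plus scale f). \<forall>v. \<phi> (pl_gen scale v) = letter scale v"
    and "\<exists>\<phi>\<in>comprelie_hom (ComPrelie scale) (T_plus scale f).
      \<forall>v. \<phi> (cpl_gen scale v) = letter scale v"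
proof -
  note cpl = comprelie_algebra_T_plus[OF f]
  show "\<exists>\<phi>\<in>prelie_hom (Prelie scale) (T_plus scale f). \<forall>v. \<phi> (pl_gen scale v) = letter scale v"
    by (rule Prelie_universal(1)[OF comprelie_algebra.axioms(1)[OF cpl] linear_into_letter])
  show "\<exists>\<phi>\<in>comprelie_hom (ComPrelie scale) (T_plus scale f).
      \<forall>v. \<phi> (cpl_gen scale v) = letter scale v"
    by (rule ComPrelie_universal(1)[OF cpl linear_into_letter])
qed

end

theory Submission
  imports Defs
begin

text \<open>
  Both questions concern the subalgebra of \<open>T\<^sub>+(V,f)\<close> generated by the letters.

  \<^emph>\<open>Obstructions in degree two.\<close>  Products of elements without constant term add up lengths, so the
  part of degree two in that subalgebra comes only from \<open>x \<bullet> y = f(x)y\<close> and, if the shuffle product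
  may be used, from \<open>x \<squnion> y = xy + yx\<close>.  A bilinear form \<open>\<beta>\<close> on \<open>V\<close> whose radicals contain
  \<open>f(V)\<close> is a linear form on \<open>V \<otimes> V\<close> killing the former, and it kills the latter as well if it is
  alternating.  If \<open>f(V) \<noteq> V\<close>, take \<open>\<beta> = l \<otimes> l\<close> for a non-zero linear form \<open>l\<close> vanishing
  on \<open>f(V)\<close>; if the codimension is at least two, take \<open>\<beta> = l \<otimes> m - m \<otimes> l\<close> for two
  independent such forms.  In both cases \<open>\<beta> \<noteq> 0\<close>, so a word of length two is missed
  (lemmas \<open>range_eq_UNIV_of_generated\<close> and \<open>codim_le_1_of_generated\<close>).

  \<^emph>\<open>Generation.\<close>  Since \<open>y \<bullet> w = f(y)w\<close>, every word whose first letter lies in \<open>f(V)\<close> is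
  obtained from a shorter one; this settles the case \<open>f(V) = V\<close>.  If \<open>V = f(V) + K v\<close>, the words
  \<open>v\<^sup>n\<close> are multiples of shuffle powers of \<open>v\<close> (here characteristic zero enters), and
  \<open>v\<^sup>k x w\<close> with \<open>x \<in> f(V)\<close> is obtained by induction on \<open>k\<close>: it occurs in \<open>v\<^sup>k \<squnion> xw\<close> with
  coefficient one, and all other terms have the form \<open>v\<^sup>j x u\<close> with \<open>j < k\<close>
  (lemma \<open>shuffle_word_replicate_leading\<close>).  Splitting the letters one after another along
  \<open>V = f(V) + K v\<close> leaves only words of these two shapes.
\<close>

section \<open>Spaces generated by the letters\<close>

text \<open>Subspaces of the tensor algebra are handled through their preimages among the formal linear
  combinations of lists, which are the subspaces containing the multilinearity relations.  The set
  of operations is a parameter so that the pre-Lie and the Com-Pre-Lie case are treated alike.\<close>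

definition subalgebra_preimage ::
  "('k::field \<Rightarrow> 'v::ab_group_add \<Rightarrow> 'v)
    \<Rightarrow> (('v list \<Rightarrow>\<^sub>0 'k) \<Rightarrow> ('v list \<Rightarrow>\<^sub>0 'k) \<Rightarrow> ('v list \<Rightarrow>\<^sub>0 'k)) set
    \<Rightarrow> ('v list \<Rightarrow>\<^sub>0 'k) set \<Rightarrow> bool" where
  "subalgebra_preimage scale ops S \<longleftrightarrow> pm.subspace S \<and> tensor_null scale \<subseteq> S \<and>
     (\<forall>v. word [v] \<in> S) \<and> (\<forall>h\<in>ops. \<forall>p\<in>S. \<forall>q\<in>S. h p q \<in> S)"

lemma tensor_class_eq:
  "tensor_rel scale `` {p} = tensor_rel scale `` {q} \<longleftrightarrow> p - q \<in> tensor_null scale"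
  using eq_equiv_class_iff[OF equiv_tensor_rel] by (auto simp: tensor_rel_def)

lemma prelie_hom_zero:
  assumes "prelie_algebra A" "prelie_algebra B" "\<phi> \<in> prelie_hom A B"
  shows "\<phi> (zero A) = zero B"
proof -
  interpret A: prelie_algebra A by fact
  interpret B: prelie_algebra B by fact
  have "\<phi> (zero A) = \<phi> (add A (zero A) (smult A (- 1) (zero A)))"
    by (simp add: A.add_uminus A.zero_closed)
  also have "\<dots> = add B (\<phi> (zero A)) (smult B (- 1) (\<phi> (zero A)))"
    using assms(3) by (simp add: prelie_hom_def A.zero_closed A.smult_closed)
  also have "\<dots> = zero B"
    using assms(3) A.zero_closed by (auto simp: prelie_hom_def intro: B.add_uminus)
  finally show ?thesis .
qed

lemma subalgebra_preimage_sub_null: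
  assumes "subalgebra_preimage scale ops S" "q \<in> S" "p - q \<in> tensor_null scale"
  shows "p \<in> S"
  using assms pm.subspace_add[of S q "p - q"] by (auto simp: subalgebra_preimage_def)

text \<open>Here \<open>c\<close> sends a term to its class, so that \<open>image\<close> can be shown by induction on terms in
  either free algebra.\<close>

lemma surj_imp_mem:
  assumes image: "\<And>s. \<exists>q\<in>S. \<phi> (c s) = tensor_rel scale `` {q}"
    and carr: "C = range c"
    and S: "subalgebra_preimage scale ops S"
    and surj: "\<phi> ` C = carrier (T_plus scale f)"
    and p: "[] \<notin> Poly_Mapping.keys p"
  shows "p \<in> S"
proof -
  have "tensor_rel scale `` {p} \<in> carrier (T_plus scale f)"
    using p by (simp add: T_plus_def quotientI)
  then obtain s where "tensor_rel scale `` {p} = \<phi> (c s)"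
    unfolding surj[symmetric] carr by blast
  moreover obtain q where "q \<in> S" "\<phi> (c s) = tensor_rel scale `` {q}" using image by blast
  ultimately show ?thesis
    using subalgebra_preimage_sub_null[OF S] by (simp add: tensor_class_eq)
qed

lemma surj_if_mem:
  assumes "\<And>p. [] \<notin> Poly_Mapping.keys p \<Longrightarrow> tensor_rel scale `` {p} \<in> \<phi> ` C"
    and "\<phi> \<in> C \<rightarrow> carrier (T_plus scale f)"
  shows "\<phi> ` C = carrier (T_plus scale f)"
proof
  show "\<phi> ` C \<subseteq> carrier (T_plus scale f)" using assms(2) by blast
  show "carrier (T_plus scale f) \<subseteq> \<phi> ` C"
  proof
    fix X assume "X \<in> carrier (T_plus scale f)"
    then obtain p where "[] \<notin> Poly_Mapping.keys p" "X = tensor_rel scale `` {p}"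
      by (auto simp: T_plus_def elim: quotientE)
    then show "X \<in> \<phi> ` C" using assms(1) by simp
  qed
qed

text \<open>The image of the free algebra is the subalgebra generated by the letters, that is, the
  intersection of all subalgebras containing them.\<close>

lemma Prelie_surj_iff:
  fixes scale :: "'k::field \<Rightarrow> 'v::ab_group_add \<Rightarrow> 'v"
  assumes f: "Vector_Spaces.linear scale scale f"
    and \<phi>: "\<phi> \<in> prelie_hom (Prelie scale) (T_plus scale f)"
    and gen: "\<And>v. \<phi> (pl_gen scale v) = letter scale v"
  shows "\<phi> ` carrier (Prelie scale) = carrier (T_plus scale f) \<longleftrightarrow>
    (\<forall>S. subalgebra_preimage scale {raw_pre f} S \<longrightarrow> {p. [] \<notin> Poly_Mapping.keys p} \<subseteq> S)"
    (is "?surj \<longleftrightarrow> ?gen")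
proof -
  let ?c = "\<lambda>s. pl_rel scale `` {s}"
  have hom: "\<phi> (?c (PAdd s t)) = add (T scale f) (\<phi> (?c s)) (\<phi> (?c t))"
    "\<phi> (?c (PScale a s)) = smult (T scale f) a (\<phi> (?c s))"
    "\<phi> (?c (PPre s t)) = pre (T scale f) (\<phi> (?c s)) (\<phi> (?c t))" for s t a
    using \<phi> by (auto simp: prelie_hom_def carrier_Prelie simp flip: Prelie_class)
  have zero: "\<phi> (?c PZero) = tensor_rel scale `` {0}"
    using prelie_hom_zero[OF prelie_algebra_Prelie
        comprelie_algebra.axioms(1)[OF comprelie_algebra_T_plus[OF f]] \<phi>] by simp
  note simps = hom T_class T_pre_class[OF f]
  show ?thesis
  proof
    assume surj: ?surj
    show ?gen
    proof (intro allI impI subsetI)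
      fix S and p :: "'v list \<Rightarrow>\<^sub>0 'k"
      assume S: "subalgebra_preimage scale {raw_pre f} S" and p: "p \<in> {p. [] \<notin> Poly_Mapping.keys p}"
      have sub: "pm.subspace S" and letters: "\<And>v. word [v] \<in> S"
        and pre: "\<And>p q. p \<in> S \<Longrightarrow> q \<in> S \<Longrightarrow> raw_pre f p q \<in> S"
        using S by (auto simp: subalgebra_preimage_def)
      have "\<exists>q\<in>S. \<phi> (?c s) = tensor_rel scale `` {q}" for s
      proof (induction s)
        case (PGen v) then show ?case using gen[of v] letters by (auto simp: pl_gen_def letter_def)
      next
        case PZero then show ?case using zero pm.subspace_0[OF sub] by blast
      next
        case (PAdd s t) then show ?case using pm.subspace_add[OF sub] by (metis simps(1) T_class(2))
      next
        case (PScale a s) then show ?case using pm.subspace_scale[OF sub] by (metis simps(2) T_class(3))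
      next
        case (PPre s t) then show ?case using pre by (metis simps(3) T_pre_class[OF f])
      qed
      from surj_imp_mem[OF this carrier_Prelie S surj] p show "p \<in> S" by simp
    qed
  next
    assume gen': ?gen
    define S where "S = {p. tensor_rel scale `` {p} \<in> \<phi> ` carrier (Prelie scale)}"
    have S_iff: "p \<in> S \<longleftrightarrow> (\<exists>s. \<phi> (?c s) = tensor_rel scale `` {p})" for p
      by (force simp: S_def carrier_Prelie)
    have "subalgebra_preimage scale {raw_pre f} S"
      unfolding subalgebra_preimage_def
    proof (intro conjI allI ballI subsetI pm.subspaceI)
      show "0 \<in> S" using zero by (auto simp: S_iff)
    next
      fix p q assume "p \<in> S" "q \<in> S"
      then show "p + q \<in> S" unfolding S_iff by (metis simps(1) T_class(2))
    next
      fix a p assume "p \<in> S"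
      then show "pm_scale a p \<in> S" unfolding S_iff by (metis simps(2) T_class(3))
    next
      fix p :: "'v list \<Rightarrow>\<^sub>0 'k" assume "p \<in> tensor_null scale"
      then have "tensor_rel scale `` {p} = tensor_rel scale `` {0}" by (simp add: tensor_class_eq)
      then show "p \<in> S" using zero by (auto simp: S_iff)
    next
      fix v show "word [v] \<in> S" using gen[of v] by (auto simp: S_iff pl_gen_def letter_def)
    next
      fix h :: "('v list \<Rightarrow>\<^sub>0 'k) \<Rightarrow> ('v list \<Rightarrow>\<^sub>0 'k) \<Rightarrow> ('v list \<Rightarrow>\<^sub>0 'k)" and p q
      assume "h \<in> {raw_pre f}" "p \<in> S" "q \<in> S"
      then show "h p q \<in> S" unfolding S_iff by (metis simps(3) T_pre_class[OF f] singletonD)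
    qed
    then have "{p. [] \<notin> Poly_Mapping.keys p} \<subseteq> S" using gen' by blast
    then show ?surj
      using \<phi> by (intro surj_if_mem) (auto simp: S_def prelie_hom_def)
  qed
qed

lemma ComPrelie_surj_iff:
  fixes scale :: "'k::field \<Rightarrow> 'v::ab_group_add \<Rightarrow> 'v"
  assumes f: "Vector_Spaces.linear scale scale f"
    and \<phi>: "\<phi> \<in> comprelie_hom (ComPrelie scale) (T_plus scale f)"
    and gen: "\<And>v. \<phi> (cpl_gen scale v) = letter scale v"
  shows "\<phi> ` carrier (ComPrelie scale) = carrier (T_plus scale f) \<longleftrightarrow>
    (\<forall>S. subalgebra_preimage scale {raw_pre f, raw_sh} S \<longrightarrow> {p. [] \<notin> Poly_Mapping.keys p} \<subseteq> S)"
    (is "?surj \<longleftrightarrow> ?gen")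
proof -
  let ?c = "\<lambda>s. cpl_rel scale `` {s}"
  have hom: "\<phi> (?c (CAdd s t)) = add (T scale f) (\<phi> (?c s)) (\<phi> (?c t))"
    "\<phi> (?c (CScale a s)) = smult (T scale f) a (\<phi> (?c s))"
    "\<phi> (?c (CPre s t)) = pre (T scale f) (\<phi> (?c s)) (\<phi> (?c t))"
    "\<phi> (?c (CSh s t)) = shuf (T scale f) (\<phi> (?c s)) (\<phi> (?c t))" for s t a
    using \<phi> by (auto simp: prelie_hom_def comprelie_hom_def carrier_ComPrelie simp flip: ComPrelie_class)
  have "\<phi> \<in> prelie_hom (ComPrelie scale) (T_plus scale f)" using \<phi> by (simp add: comprelie_hom_def)
  then have zero: "\<phi> (?c CZero) = tensor_rel scale `` {0}"
    using prelie_hom_zero[OF comprelie_algebra.axioms(1)[OF comprelie_algebra_ComPrelie]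
        comprelie_algebra.axioms(1)[OF comprelie_algebra_T_plus[OF f]]] by simp
  show ?thesis
  proof
    assume surj: ?surj
    show ?gen
    proof (intro allI impI subsetI)
      fix S and p :: "'v list \<Rightarrow>\<^sub>0 'k"
      assume S: "subalgebra_preimage scale {raw_pre f, raw_sh} S"
        and p: "p \<in> {p. [] \<notin> Poly_Mapping.keys p}"
      have sub: "pm.subspace S" and letters: "\<And>v. word [v] \<in> S"
        and pre: "\<And>p q. p \<in> S \<Longrightarrow> q \<in> S \<Longrightarrow> raw_pre f p q \<in> S"
        and sh: "\<And>p q. p \<in> S \<Longrightarrow> q \<in> S \<Longrightarrow> raw_sh p q \<in> S"
        using S by (auto simp: subalgebra_preimage_def)
      have "\<exists>q\<in>S. \<phi> (?c s) = tensor_rel scale `` {q}" for s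
      proof (induction s)
        case (CGen v) then show ?case using gen[of v] letters by (auto simp: cpl_gen_def letter_def)
      next
        case CZero then show ?case using zero pm.subspace_0[OF sub] by blast
      next
        case (CAdd s t) then show ?case using pm.subspace_add[OF sub] by (metis hom(1) T_class(2))
      next
        case (CScale a s) then show ?case using pm.subspace_scale[OF sub] by (metis hom(2) T_class(3))
      next
        case (CPre s t) then show ?case using pre by (metis hom(3) T_pre_class[OF f])
      next
        case (CSh s t) then show ?case using sh by (metis hom(4) T_class(4))
      qed
      from surj_imp_mem[OF this carrier_ComPrelie S surj] p show "p \<in> S" by simp
    qed
  next
    assume gen': ?gen
    define S where "S = {p. tensor_rel scale `` {p} \<in> \<phi> ` carrier (ComPrelie scale)}"
    have S_iff: "p \<in> S \<longleftrightarrow> (\<exists>s. \<phi> (?c s) = tensor_rel scale `` {p})" for p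
      by (force simp: S_def carrier_ComPrelie)
    have pre: "raw_pre f p q \<in> S" and sh: "raw_sh p q \<in> S" if "p \<in> S" "q \<in> S" for p q
      using that unfolding S_iff by (metis hom(3) T_pre_class[OF f], metis hom(4) T_class(4))
    have "subalgebra_preimage scale {raw_pre f, raw_sh} S"
      unfolding subalgebra_preimage_def
    proof (intro conjI allI ballI subsetI pm.subspaceI)
      show "0 \<in> S" using zero by (auto simp: S_iff)
    next
      fix p q assume "p \<in> S" "q \<in> S"
      then show "p + q \<in> S" unfolding S_iff by (metis hom(1) T_class(2))
    next
      fix a p assume "p \<in> S"
      then show "pm_scale a p \<in> S" unfolding S_iff by (metis hom(2) T_class(3))
    next
      fix p :: "'v list \<Rightarrow>\<^sub>0 'k" assume "p \<in> tensor_null scale"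
      then have "tensor_rel scale `` {p} = tensor_rel scale `` {0}" by (simp add: tensor_class_eq)
      then show "p \<in> S" using zero by (auto simp: S_iff)
    next
      fix v show "word [v] \<in> S" using gen[of v] by (auto simp: S_iff cpl_gen_def letter_def)
    next
      fix h :: "('v list \<Rightarrow>\<^sub>0 'k) \<Rightarrow> ('v list \<Rightarrow>\<^sub>0 'k) \<Rightarrow> ('v list \<Rightarrow>\<^sub>0 'k)" and p q
      assume "h \<in> {raw_pre f, raw_sh}" "p \<in> S" "q \<in> S"
      then show "h p q \<in> S" using pre sh by auto
    qed
    then have "{p. [] \<notin> Poly_Mapping.keys p} \<subseteq> S" using gen' by blast
    then show ?surj
      using \<phi> by (intro surj_if_mem) (auto simp: S_def prelie_hom_def comprelie_hom_def)
  qed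
qed

section \<open>Homogeneity of the products\<close>

abbreviation words_of_length :: "nat \<Rightarrow> ('v list \<Rightarrow>\<^sub>0 'k::field) set" where
  "words_of_length n \<equiv> pm.span {word w | w. length w = n}"

lemma span_image_subset:
  assumes "pm_linear F" "p \<in> pm.span A" "\<And>a. a \<in> A \<Longrightarrow> F a \<in> pm.span B"
  shows "F p \<in> pm.span B"
proof -
  interpret F: Vector_Spaces.linear pm_scale pm_scale F by fact
  have "pm.subspace {p. F p \<in> pm.span B}"
    using F.subspace_vimage[OF pm.subspace_span] by (simp add: vimage_def)
  from assms(2) this assms(3) show ?thesis by (rule pm.span_induct)
qed

lemma prepend_words_of_length:
  "p \<in> words_of_length n \<Longrightarrow> prepend x p \<in> words_of_length (Suc n)"
  by (erule span_image_subset[OF linear_prepend]) (auto intro!: pm.span_base)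

lemma shuffle_word_length:
  "(shuffle_word u v :: 'v list \<Rightarrow>\<^sub>0 'k::field) \<in> words_of_length (length u + length v)"
proof (induction u v rule: shuffle_word.induct)
  case (3 x u y v)
  show ?case
    using prepend_words_of_length[OF 3(1), of x] prepend_words_of_length[OF 3(2), of y]
    by (auto intro: pm.span_add)
qed (auto intro!: pm.span_base)

lemma pre_word_length:
  "(pre_word f u v :: 'v list \<Rightarrow>\<^sub>0 'k::field) \<in> words_of_length (length u + length v)"
proof (induction u)
  case (Cons x u)
  show ?case
    using prepend_words_of_length[OF Cons, of x]
      prepend_words_of_length[OF shuffle_word_length[of u v], of "f x"]
    by (auto intro: pm.span_add)
qed (simp add: pm.span_zero)

section \<open>Obstructions in degree two\<close>

text \<open>The linear form on \<open>V \<otimes> V\<close> given by \<open>\<beta>\<close>, extended by zero to the other degrees.  Its scalar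
  value is stored as the coefficient of the empty word, so that linear extension applies.\<close>

definition degree2_form :: "('v \<Rightarrow> 'v \<Rightarrow> 'k::field) \<Rightarrow> ('v list \<Rightarrow>\<^sub>0 'k) \<Rightarrow> ('v list \<Rightarrow>\<^sub>0 'k)" where
  "degree2_form \<beta> = linear_ext (\<lambda>w. case w of [x, y] \<Rightarrow> pm_scale (\<beta> x y) (word []) | _ \<Rightarrow> 0)"

lemma degree2_form_simps [simp]:
  "degree2_form \<beta> (p + q) = degree2_form \<beta> p + degree2_form \<beta> q"
  "degree2_form \<beta> (p - q) = degree2_form \<beta> p - degree2_form \<beta> q"
  "degree2_form \<beta> (pm_scale c p) = pm_scale c (degree2_form \<beta> p)"
  "degree2_form \<beta> 0 = 0"
  "degree2_form \<beta> (word [x, y]) = pm_scale (\<beta> x y) (word [])"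
  by (simp_all add: degree2_form_def)

lemma word_neq_0 [simp]: "word w \<noteq> (0 :: 'v list \<Rightarrow>\<^sub>0 'k::field)"
  by (metis lookup_single_eq lookup_zero zero_neq_one)

lemma degree2_form_word_eq_0: "length w \<noteq> 2 \<Longrightarrow> degree2_form \<beta> (word w) = 0"
  by (auto simp: degree2_form_def split: list.splits)

lemma degree2_form_kernel_subspace: "pm.subspace {p. degree2_form \<beta> p = 0}"
  by (rule pm.subspaceI) auto

lemma degree2_form_eq_0_of_length:
  assumes "p \<in> words_of_length n" "n \<noteq> 2"
  shows "degree2_form \<beta> p = 0"
  by (rule pm.span_induct[OF assms(1) degree2_form_kernel_subspace])
     (use assms(2) in \<open>auto simp: degree2_form_word_eq_0\<close>)

lemma degree2_form_null:
  fixes scale :: "'k::field \<Rightarrow> 'v::ab_group_add \<Rightarrow> 'v"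
  assumes \<beta>: "\<And>x. Vector_Spaces.linear scale (*) (\<beta> x)" "\<And>y. Vector_Spaces.linear scale (*) (\<lambda>x. \<beta> x y)"
    and p: "p \<in> tensor_null scale"
  shows "degree2_form \<beta> p = 0"
proof -
  note add = \<beta>[THEN linear_iff_module_hom[THEN iffD1], THEN module_hom.add]
  note scl = \<beta>[THEN linear_iff_module_hom[THEN iffD1], THEN module_hom.scale]
  have word2: "u = [] \<and> (\<exists>b. w = [b]) \<or> (\<exists>a. u = [a]) \<and> w = []"
    if "length u + length w = 1" for u w :: "'v list"
    using that by (cases u; cases w) auto
  have A: "degree2_form \<beta> (word (u @ (x + y) # w) - word (u @ x # w) - word (u @ y # w)) = 0" for u x y w
    using word2[of u w]
    by (cases "length u + length w = 1") (auto simp: add degree2_form_word_eq_0 pm.scale_left_distrib)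
  have B: "degree2_form \<beta> (word (u @ scale c x # w) - pm_scale c (word (u @ x # w))) = 0" for u x c w
    using word2[of u w]
    by (cases "length u + length w = 1") (auto simp: scl degree2_form_word_eq_0)
  show ?thesis
    by (rule pm.span_induct[OF p[unfolded tensor_null_def] degree2_form_kernel_subspace])
       (use A B in auto)
qed

text \<open>Each word of length two in a pre-Lie product of words contains a letter from the range of
  \<open>f\<close>.\<close>

lemma degree2_form_raw_pre:
  assumes "\<And>x y. \<beta> (f x) y = 0" "\<And>x y. \<beta> x (f y) = 0"
  shows "degree2_form \<beta> (raw_pre f p q) = 0"
proof -
  have w: "degree2_form \<beta> (pre_word f u v) = 0" for u v
  proof (cases "length u + length v = 2")
    case False then show ?thesis by (rule degree2_form_eq_0_of_length[OF pre_word_length])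
  next
    case True
    then have "u = [] \<or> (\<exists>x y. u = [x] \<and> v = [y]) \<or> (\<exists>x y. u = [x, y] \<and> v = [])"
      by (auto simp: numeral_2_eq_2 length_Suc_conv neq_Nil_conv add_eq_if split: if_splits)
    then show ?thesis using assms by auto
  qed
  have u: "degree2_form \<beta> (raw_pre f (word u) q) = 0" for u
    by (induction q rule: pm_induct) (simp_all add: w)
  show ?thesis by (induction p rule: pm_induct) (simp_all add: u)
qed

text \<open>An alternating form behaves like an infinitesimal character of the shuffle algebra, so it
  vanishes on shuffles of elements without constant term.\<close>

lemma degree2_form_raw_sh:
  assumes "\<And>x y. \<beta> x y + \<beta> y x = 0"
  shows "degree2_form \<beta> (raw_sh p q) =
    pm_scale (Poly_Mapping.lookup p []) (degree2_form \<beta> q) +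
    pm_scale (Poly_Mapping.lookup q []) (degree2_form \<beta> p)"
proof -
  have w: "degree2_form \<beta> (shuffle_word u v) =
    pm_scale (Poly_Mapping.lookup (word u) []) (degree2_form \<beta> (word v)) +
    pm_scale (Poly_Mapping.lookup (word v) []) (degree2_form \<beta> (word u))" for u v
  proof (cases "u = [] \<or> v = []")
    case True
    then show ?thesis by (auto simp: lookup_single degree2_form_word_eq_0 when_def)
  next
    case ne: False
    have "degree2_form \<beta> (shuffle_word u v) = 0"
    proof (cases "length u + length v = 2")
      case False then show ?thesis by (rule degree2_form_eq_0_of_length[OF shuffle_word_length])
    next
      case True
      then obtain x y where "u = [x]" "v = [y]"
        using ne by (cases u; cases v) auto
      then show ?thesis using assms[of x y] by (simp flip: pm.scale_left_distrib)
    qed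
    then show ?thesis using ne by (simp add: lookup_single when_def)
  qed
  have u: "degree2_form \<beta> (raw_sh (word u) q) =
    pm_scale (Poly_Mapping.lookup (word u) []) (degree2_form \<beta> q) +
    pm_scale (Poly_Mapping.lookup q []) (degree2_form \<beta> (word u))" for u
    by (induction q rule: pm_induct)
       (simp_all add: w lookup_add pm.scale_left_distrib pm.scale_right_distrib mult.commute)
  show ?thesis
    by (induction p rule: pm_induct)
       (simp_all add: u lookup_add pm.scale_left_distrib pm.scale_right_distrib mult.commute)
qed

lemma lookup_Nil_null: "p \<in> tensor_null scale \<Longrightarrow> Poly_Mapping.lookup p [] = 0"
proof -
  assume p: "p \<in> tensor_null scale"
  have "pm.subspace {p. Poly_Mapping.lookup p [] = 0}"
    by (rule pm.subspaceI) (auto simp: lookup_add)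
  from p[unfolded tensor_null_def] this show ?thesis
    by (rule pm.span_induct) (auto simp: lookup_minus lookup_single)
qed

lemma degree2_form_subalgebra_preimage:
  assumes "\<And>x. Vector_Spaces.linear scale (*) (\<beta> x)" "\<And>y. Vector_Spaces.linear scale (*) (\<lambda>x. \<beta> x y)"
    and "\<And>x y. \<beta> (f x) y = 0" "\<And>x y. \<beta> x (f y) = 0"
    and "raw_sh \<in> ops \<Longrightarrow> \<forall>x y. \<beta> x y + \<beta> y x = 0" "ops \<subseteq> {raw_pre f, raw_sh}"
  shows "subalgebra_preimage scale ops {p. [] \<notin> Poly_Mapping.keys p \<and> degree2_form \<beta> p = 0}"
    (is "subalgebra_preimage scale ops ?S")
proof -
  have "h p q \<in> ?S" if h: "h \<in> ops" and pq: "p \<in> ?S" "q \<in> ?S" for h p q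
  proof (cases "h = raw_pre f")
    case True then show ?thesis using keys_raw_pre degree2_form_raw_pre[of \<beta> f p q] assms(3,4) by auto
  next
    case False
    then have "h = raw_sh" using h assms(6) by auto
    then show ?thesis using pq h assms(5) keys_raw_sh degree2_form_raw_sh[of \<beta> p q] by auto
  qed
  moreover have "pm.subspace ?S" by (rule pm.subspaceI) (auto simp: in_keys_iff lookup_add)
  moreover have "tensor_null scale \<subseteq> ?S"
    using degree2_form_null[OF assms(1,2)] lookup_Nil_null[of _ scale] by (auto simp: in_keys_iff)
  ultimately show ?thesis by (auto simp: subalgebra_preimage_def degree2_form_word_eq_0)
qed

lemma vector_space_mult: "vector_space ((*) :: 'k::field \<Rightarrow> 'k \<Rightarrow> 'k)"
  by unfold_locales (simp_all add: algebra_simps)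

lemma separating_linear_form:
  fixes scale :: "'k::field \<Rightarrow> 'v::ab_group_add \<Rightarrow> 'v"
  assumes "vector_space scale" "module.subspace scale W" "v \<notin> W"
  obtains l where "Vector_Spaces.linear scale (*) l" "\<And>w. w \<in> W \<Longrightarrow> l w = 0" "l v = 1"
proof -
  interpret vector_space scale by fact
  interpret k: vector_space_pair scale "(*) :: 'k \<Rightarrow> _"
    by (intro vector_space_pair.intro assms(1) vector_space_mult)
  obtain B where B: "B \<subseteq> W" "independent B" "W \<subseteq> span B"
    using maximal_independent_subset by blast
  have "v \<notin> span B" using B(1) assms(2,3) span_minimal by blast
  then have "independent (insert v B)" using B(2) by (rule independent_insertI)
  then obtain l where l: "Vector_Spaces.linear scale (*) l" "\<forall>x\<in>insert v B. l x = (if x = v then 1 else 0)"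
    using k.linear_independent_extend[of _ "\<lambda>x. if x = v then 1 else 0"] by blast
  have "l w = 0" if "w \<in> W" for w
  proof (rule k.linear_eq_0_on_span[OF l(1)])
    show "w \<in> span B" using that B(3) by blast
    fix b assume "b \<in> B"
    then show "l b = 0" using l(2) B(1) assms(3) by auto
  qed
  with l that show thesis by auto
qed

lemma subspace_range:
  assumes "Vector_Spaces.linear scale scale f"
  shows "module.subspace scale (range f)"
proof -
  interpret f: Vector_Spaces.linear scale scale f by fact
  show ?thesis by (rule f.subspace_image[OF f.vs1.subspace_UNIV])
qed

lemma linear_form_scale:
  assumes "Vector_Spaces.linear scale (*) l"
  shows "Vector_Spaces.linear scale (*) (\<lambda>x. c * l x)"
    and "Vector_Spaces.linear scale (*) (\<lambda>x. l x * c)"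
  using assms by (simp_all add: linear_iff_module_hom module_hom_iff algebra_simps)

lemma range_eq_UNIV_of_generated:
  fixes scale :: "'k::field \<Rightarrow> 'v::ab_group_add \<Rightarrow> 'v"
  assumes vs: "vector_space scale" and f: "Vector_Spaces.linear scale scale f"
    and gen: "\<And>S. subalgebra_preimage scale {raw_pre f} S \<Longrightarrow> {p. [] \<notin> Poly_Mapping.keys p} \<subseteq> S"
  shows "range f = UNIV"
proof (rule ccontr)
  assume "range f \<noteq> UNIV"
  then obtain v where "v \<notin> range f" by blast
  from separating_linear_form[OF vs subspace_range[OF f] this]
  obtain l where l: "Vector_Spaces.linear scale (*) l" "\<And>w. w \<in> range f \<Longrightarrow> l w = 0" "l v = 1" by metis
  define \<beta> where "\<beta> x y = l x * l y" for x y
  \<comment> \<open>The form is not alternating, so the shuffle product must not be among the operations.\<close>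
  have "raw_sh \<noteq> (raw_pre f :: ('v list \<Rightarrow>\<^sub>0 'k) \<Rightarrow> _)"
  proof
    assume "raw_sh = (raw_pre f :: ('v list \<Rightarrow>\<^sub>0 'k) \<Rightarrow> _)"
    then have "raw_sh (word []) (word []) = (raw_pre f (word []) (word []) :: 'v list \<Rightarrow>\<^sub>0 'k)" by metis
    then have "word [] = (0 :: 'v list \<Rightarrow>\<^sub>0 'k)" by simp
    then show False by simp
  qed
  then have "subalgebra_preimage scale {raw_pre f} {p. [] \<notin> Poly_Mapping.keys p \<and> degree2_form \<beta> p = 0}"
    using l(2) by (intro degree2_form_subalgebra_preimage)
      (auto simp: \<beta>_def[abs_def] intro: linear_form_scale[OF l(1)])
  from subsetD[OF gen[OF this], of "word [v, v]"] show False by (simp add: \<beta>_def l)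
qed

lemma codim_le_1_of_generated:
  fixes scale :: "'k::field \<Rightarrow> 'v::ab_group_add \<Rightarrow> 'v"
  assumes vs: "vector_space scale" and f: "Vector_Spaces.linear scale scale f"
    and gen: "\<And>S. subalgebra_preimage scale {raw_pre f, raw_sh} S \<Longrightarrow> {p. [] \<notin> Poly_Mapping.keys p} \<subseteq> S"
  shows "codim scale (range f) \<le> 1"
  unfolding codim_def
proof (rule SUP_least)
  interpret vector_space scale by fact
  note sub = subspace_range[OF f]
  fix B assume "B \<in> {B. finite B \<and> independent_mod scale (range f) B}"
  then have fin: "finite B" and ind: "independent_mod scale (range f) B" by auto
  \<comment> \<open>Dual vectors modulo \<open>f(V)\<close> for two elements of \<open>B\<close>.\<close>
  have dual: "\<exists>l. Vector_Spaces.linear scale (*) l \<and> (\<forall>w\<in>range f. l w = 0) \<and> l a = 1 \<and> l b = 0"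
    if ab: "a \<in> B" "b \<in> B" "a \<noteq> b" for a b
  proof -
    have "a \<notin> span (insert b (range f))"
    proof
      assume "a \<in> span (insert b (range f))"
      then obtain k where k: "a - scale k b \<in> range f"
        using span_breakdown_eq[of a b "range f"] span_eq_iff[THEN iffD2, OF sub] by auto
      define c where "c x = (if x = a then 1 else if x = b then - k else 0)" for x
      have "(\<Sum>x\<in>B. scale (c x) x) = (\<Sum>x\<in>{a, b}. scale (c x) x)"
        using fin ab by (intro sum.mono_neutral_right) (auto simp: c_def)
      also have "\<dots> = a - scale k b" using ab by (simp add: c_def)
      finally have "c a = 0" using ind k ab(1) by (simp add: independent_mod_def)
      then show False by (simp add: c_def)
    qed
    from separating_linear_form[OF vs subspace_span this] obtain l
      where "Vector_Spaces.linear scale (*) l" "\<And>w. w \<in> span (insert b (range f)) \<Longrightarrow> l w = 0" "l a = 1"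
      by metis
    then show ?thesis by (intro exI[of _ l]) (auto intro: span_base)
  qed
  show "enat (card B) \<le> 1"
  proof (rule ccontr)
    assume "\<not> enat (card B) \<le> 1"
    then have "card B > 1" by (simp add: one_enat_def)
    then obtain a b where ab: "a \<in> B" "b \<in> B" "a \<noteq> b"
      by (metis card_le_Suc0_iff_eq fin One_nat_def not_le)
    obtain l where l: "Vector_Spaces.linear scale (*) l" "\<forall>w\<in>range f. l w = 0" "l a = 1" "l b = 0"
      using dual[OF ab] by blast
    obtain m where m: "Vector_Spaces.linear scale (*) m" "\<forall>w\<in>range f. m w = 0" "m b = 1" "m a = 0"
      using dual[OF ab(2,1)] ab(3) by blast
    define \<beta> where "\<beta> x y = l x * m y - m x * l y" for x y
    interpret k: vector_space_pair scale "(*) :: 'k \<Rightarrow> _"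
      by (intro vector_space_pair.intro vs vector_space_mult)
    have "subalgebra_preimage scale {raw_pre f, raw_sh} {p. [] \<notin> Poly_Mapping.keys p \<and> degree2_form \<beta> p = 0}"
      using l(2) m(2) by (intro degree2_form_subalgebra_preimage)
        (auto simp: \<beta>_def[abs_def] intro!: k.linear_compose_sub linear_form_scale l(1) m(1))
    from subsetD[OF gen[OF this], of "word [a, b]"] show False by (simp add: \<beta>_def l m)
  qed
qed

section \<open>Generation of all words\<close>

lemma mem_of_words:
  assumes S: "pm.subspace S" and words: "\<And>w. w \<noteq> [] \<Longrightarrow> word w \<in> S"
    and p: "[] \<notin> Poly_Mapping.keys p"
  shows "p \<in> S"
proof -
  have "linear_ext word p \<in> S"
    unfolding linear_ext_def using p
    by (intro pm.subspace_sum[OF S] pm.subspace_scale[OF S] words) auto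
  then show ?thesis by (subst pm_expand)
qed

lemma subalgebra_preimage_cons:
  assumes S: "subalgebra_preimage scale ops S" "raw_pre f \<in> ops" and w: "w \<noteq> [] \<Longrightarrow> word w \<in> S"
  shows "word (f y # w) \<in> S"
proof (cases "w = []")
  case True then show ?thesis using S by (simp add: subalgebra_preimage_def)
next
  case False
  have "raw_pre f (word [y]) (word w) \<in> S" using S w[OF False] unfolding subalgebra_preimage_def by blast
  then show ?thesis by simp
qed

lemma words_generated_of_surj:
  assumes S: "subalgebra_preimage scale {raw_pre f} S" and f: "range f = UNIV" and w: "w \<noteq> []"
  shows "word w \<in> S"
  using w
proof (induction w)
  case (Cons x w)
  obtain y where "x = f y" using f by blast
  then show ?case using subalgebra_preimage_cons[OF S, of f w y] Cons by simp
qed simp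

lemma shuffle_word_replicate:
  "shuffle_word [v] (replicate n v) = pm_scale (of_nat (Suc n)) (word (replicate (Suc n) v))"
proof (induction n)
  case (Suc n)
  have "pm_scale 2 p = p + p" for p :: "'a list \<Rightarrow>\<^sub>0 'b"
    using pm.scale_left_distrib[of 1 1 p] by simp
  with Suc show ?case by (simp add: pm.scale_left_distrib)
qed simp

text \<open>The shuffles of \<open>v\<^sup>k\<close> with \<open>xw\<close> are sorted by the number of letters \<open>v\<close> put in front of
  \<open>x\<close>; exactly one of them has all \<open>k\<close> there.\<close>

lemma shuffle_word_replicate_leading:
  "(shuffle_word (replicate k v) (x # w) - word (replicate k v @ x # w) :: 'v list \<Rightarrow>\<^sub>0 'k::field)
     \<in> pm.span {word (replicate j v @ x # u) | j u. j < k \<and> j + length u = k + length w}"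
    (is "_ \<in> pm.span (?A k)")
proof (induction k)
  case (Suc k)
  have "prepend v (shuffle_word (replicate k v) (x # w) - word (replicate k v @ x # w)) \<in> pm.span (?A (Suc k))"
  proof (rule span_image_subset[OF linear_prepend Suc])
    fix a assume "a \<in> ?A k"
    then obtain j u where "a = word (replicate j v @ x # u)" "j < k" "j + length u = k + length w" by blast
    then show "prepend v a \<in> pm.span (?A (Suc k))"
      by (auto intro!: pm.span_base exI[of _ "Suc j"] exI[of _ u])
  qed
  moreover have "prepend x (shuffle_word (replicate (Suc k) v) w) \<in> pm.span (?A (Suc k))"
  proof (rule span_image_subset[OF linear_prepend shuffle_word_length])
    fix a :: "'v list \<Rightarrow>\<^sub>0 'k"
    assume "a \<in> {word u |u. length u = length (replicate (Suc k) v) + length w}"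
    then show "prepend x a \<in> pm.span (?A (Suc k))"
      by (auto intro!: pm.span_base exI[of _ "0::nat"])
  qed
  ultimately have "prepend v (shuffle_word (replicate k v) (x # w) - word (replicate k v @ x # w)) +
      prepend x (shuffle_word (replicate (Suc k) v) w) \<in> pm.span (?A (Suc k))"
    by (rule pm.span_add)
  then show ?case by (simp add: algebra_simps)
qed (simp add: pm.span_zero)

lemma words_generated_of_codim_1:
  fixes scale :: "'k::field_char_0 \<Rightarrow> 'v::ab_group_add \<Rightarrow> 'v"
  assumes S: "subalgebra_preimage scale {raw_pre f, raw_sh} S"
    and split: "\<And>x. \<exists>y c. x = f y + scale c v" and w: "w \<noteq> []"
  shows "word w \<in> S"
  using w
proof (induction "length w" arbitrary: w rule: less_induct)
  case less
  have sub: "pm.subspace S" and null: "tensor_null scale \<subseteq> S" and letters: "\<And>v. word [v] \<in> S"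
    and sh: "\<And>p q. p \<in> S \<Longrightarrow> q \<in> S \<Longrightarrow> raw_sh p q \<in> S"
    using S by (auto simp: subalgebra_preimage_def)
  have power: "word (replicate (Suc n) v) \<in> S" for n
  proof (induction n)
    case (Suc n)
    have "raw_sh (word [v]) (word (replicate (Suc n) v)) \<in> S" by (rule sh[OF letters Suc])
    then have "pm_scale (of_nat (Suc (Suc n))) (word (replicate (Suc (Suc n)) v)) \<in> S"
      by (simp only: bilinear_ext_simps(5) shuffle_word_replicate)
    then have "pm_scale (1 / of_nat (Suc (Suc n)))
        (pm_scale (of_nat (Suc (Suc n))) (word (replicate (Suc (Suc n)) v))) \<in> S"
      by (rule pm.subspace_scale[OF sub])
    then show ?case by (simp del: of_nat_Suc replicate_Suc)
  qed (use letters in simp)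
  have front: "word (replicate k v @ f y # u) \<in> S" if "k + Suc (length u) = length w" for k y u
    using that
  proof (induction k arbitrary: u rule: less_induct)
    case k: (less k)
    show ?case
    proof (cases k)
      case 0
      then show ?thesis
        using subalgebra_preimage_cons[OF S, of f u y] less(1)[of u] k(2) by simp
    next
      case (Suc k')
      have "word (replicate k v) \<in> S" using power Suc by simp
      moreover have "word (f y # u) \<in> S" using less(1)[of "f y # u"] k(2) Suc by simp
      ultimately have "shuffle_word (replicate k v) (f y # u) \<in> S" using sh by fastforce
      moreover have "shuffle_word (replicate k v) (f y # u) - word (replicate k v @ f y # u) \<in> S"
      proof (rule subsetD[OF pm.span_minimal[OF _ sub] shuffle_word_replicate_leading])
        show "{word (replicate j v @ f y # u') | j u'. j < k \<and> j + length u' = k + length u} \<subseteq> S"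
          using k by auto
      qed
      ultimately show ?thesis using pm.subspace_diff[OF sub] by fastforce
    qed
  qed
  \<comment> \<open>Letters in \<open>f(V)\<close> are absorbed by the previous step; a multiple of \<open>v\<close> is moved into the power of \<open>v\<close>.\<close>
  have "word (replicate k v @ u) \<in> S" if "k + length u = length w" for k u
    using that
  proof (induction u arbitrary: k)
    case Nil
    then show ?case using power[of "k - 1"] less(2) by simp
  next
    case (Cons x u)
    obtain y c where x: "x = f y + scale c v" using split by blast
    let ?w = "\<lambda>z. word (replicate k v @ z # u)"
    have "?w (f y + scale c v) - ?w (f y) - ?w (scale c v) \<in> S" "?w (scale c v) - pm_scale c (?w v) \<in> S"
      using null lin_mod_word[of scale "replicate k v" u] by (auto simp: lin_mod_def)
    moreover have "?w (f y) \<in> S" using front Cons(2) by simp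
    moreover have "?w v \<in> S"
      using Cons(1)[of "Suc k"] Cons(2) by (simp add: replicate_app_Cons_same)
    ultimately have "(?w x - ?w (f y) - ?w (scale c v)) + (?w (scale c v) - pm_scale c (?w v))
        + ?w (f y) + pm_scale c (?w v) \<in> S"
      unfolding x by (intro pm.subspace_add[OF sub] pm.subspace_scale[OF sub])
    then show ?case by simp
  qed
  from this[of 0 w] show ?case by simp
qed

lemma codim_le_1_split:
  assumes vs: "vector_space scale" and f: "Vector_Spaces.linear scale scale f"
    and codim: "codim scale (range f) \<le> 1"
  obtains v where "\<And>x. \<exists>y c. x = f y + scale c v"
proof (cases "range f = UNIV")
  case True
  interpret vector_space scale by fact
  have "\<exists>y c. x = f y + scale c 0" for x using True by (metis scale_zero_right add_0_right surjD)
  with that show thesis by blast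
next
  case False
  interpret vector_space scale by fact
  note sub = subspace_range[OF f]
  from False obtain v where v: "v \<notin> range f" by blast
  have "\<exists>y c. x = f y + scale c v" for x
  proof (rule ccontr)
    assume "\<not> ?thesis"
    then have no: "x - scale c v \<notin> range f" for c by (force simp: algebra_simps)
    have "v \<noteq> x" using no[of 1] subspace_0[OF sub] by auto
    have "independent_mod scale (range f) {v, x}"
      unfolding independent_mod_def
    proof (intro allI impI)
      fix c assume "(\<Sum>b\<in>{v, x}. scale (c b) b) \<in> range f"
      then have in_range: "scale (c v) v + scale (c x) x \<in> range f" using \<open>v \<noteq> x\<close> by simp
      have cx: "c x = 0"
      proof (rule ccontr)
        assume "c x \<noteq> 0"
        then have "scale (inverse (c x)) (scale (c v) v + scale (c x) x) = x - scale (- c v / c x) v"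
          by (simp add: scale_right_distrib field_simps)
        then show False using subspace_scale[OF sub in_range] no by metis
      qed
      have "c v = 0"
      proof (rule ccontr)
        assume "c v \<noteq> 0"
        then have "scale (inverse (c v)) (scale (c v) v + scale (c x) x) = v"
          using cx by simp
        then show False using subspace_scale[OF sub in_range] v by metis
      qed
      with cx show "\<forall>b\<in>{v, x}. c b = 0" by simp
    qed
    then have "enat (card {v, x}) \<le> codim scale (range f)"
      unfolding codim_def by (intro SUP_upper) simp
    also have "\<dots> \<le> 1" by (rule codim)
    finally show False using \<open>v \<noteq> x\<close> by (simp add: one_enat_def)
  qed
  with that show thesis by blast
qed

section \<open>Surjectivity of the two morphisms\<close>

theorem theorem32:
  fixes scale :: "'k::field_char_0 \<Rightarrow> 'v::ab_group_add \<Rightarrow> 'v"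
    and f :: "'v \<Rightarrow> 'v"
    and \<phi>_PL :: "('k, 'v) plterm set \<Rightarrow> ('v list \<Rightarrow>\<^sub>0 'k) set"
    and \<phi>_CPL :: "('k, 'v) cplterm set \<Rightarrow> ('v list \<Rightarrow>\<^sub>0 'k) set"
  assumes "vector_space scale"
    and "Vector_Spaces.linear scale scale f"
    and "\<phi>_PL \<in> prelie_hom (Prelie scale) (T_plus scale f)"
    and "\<And>v. \<phi>_PL (pl_gen scale v) = letter scale v"
    and "\<phi>_CPL \<in> comprelie_hom (ComPrelie scale) (T_plus scale f)"
    and "\<And>v. \<phi>_CPL (cpl_gen scale v) = letter scale v"
  shows "(\<phi>_PL ` carrier (Prelie scale) = carrier (T_plus scale f) \<longleftrightarrow> range f = UNIV) \<and>
    (\<phi>_CPL ` carrier (ComPrelie scale) = carrier (T_plus scale f) \<longleftrightarrow> codim scale (range f) \<le> 1)"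
proof
  show "\<phi>_PL ` carrier (Prelie scale) = carrier (T_plus scale f) \<longleftrightarrow> range f = UNIV"
    unfolding Prelie_surj_iff[OF assms(2-4)]
  proof
    assume onto: "range f = UNIV"
    show "\<forall>S. subalgebra_preimage scale {raw_pre f} S \<longrightarrow> {p. [] \<notin> Poly_Mapping.keys p} \<subseteq> S"
    proof (intro allI impI subsetI)
      fix S and p :: "'v list \<Rightarrow>\<^sub>0 'k"
      assume S: "subalgebra_preimage scale {raw_pre f} S" and p: "p \<in> {p. [] \<notin> Poly_Mapping.keys p}"
      have "pm.subspace S" using S by (simp add: subalgebra_preimage_def)
      then show "p \<in> S" using words_generated_of_surj[OF S onto] p by (auto intro: mem_of_words)
    qed
  qed (rule range_eq_UNIV_of_generated[OF assms(1,2)], blast)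
  show "\<phi>_CPL ` carrier (ComPrelie scale) = carrier (T_plus scale f) \<longleftrightarrow> codim scale (range f) \<le> 1"
    unfolding ComPrelie_surj_iff[OF assms(2,5,6)]
  proof
    assume "codim scale (range f) \<le> 1"
    then obtain v where v: "\<And>x. \<exists>y c. x = f y + scale c v"
      using codim_le_1_split[OF assms(1,2)] by blast
    show "\<forall>S. subalgebra_preimage scale {raw_pre f, raw_sh} S \<longrightarrow> {p. [] \<notin> Poly_Mapping.keys p} \<subseteq> S"
    proof (intro allI impI subsetI)
      fix S and p :: "'v list \<Rightarrow>\<^sub>0 'k"
      assume S: "subalgebra_preimage scale {raw_pre f, raw_sh} S"
        and p: "p \<in> {p. [] \<notin> Poly_Mapping.keys p}"
      have "pm.subspace S" using S by (simp add: subalgebra_preimage_def)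
      then show "p \<in> S" using words_generated_of_codim_1[OF S v] p by (auto intro: mem_of_words)
    qed
  qed (rule codim_le_1_of_generated[OF assms(1,2)], blast)
qed

end
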